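(* Let $W=G(m,1,n)$ and let $H_R$ be the generic rational Cherednik algebra of $W$ over $R=\mathbb{C}[\underline{t},\underline{\kappa},\underline{c}_1,\dots,\underline{c}_{m-1}]$, with Dunkl–Opdam elements $z_1,\dots,z_n\in H_R$. For $1\leq r\leq n$ let $$\mathfrak{S}_r=\sum_{1\leq j_1<j_2<\dots<j_r\leq n}z_{j_1}z_{j_2}\cdots z_{j_r}.$$ Then $[x_1,\mathfrak{S}_r]\in\underline{t}H_R$. In particular, for every $c=(0;\kappa,c_1,\dots,c_{m-1})\in\mathbb{C}^{m+1}$, the image of $\mathfrak{S}_r$ in the specialised algebra $H_c$ is central in $H_c$.
   Context: Let $m,n\geq 1$, let $\eta\in\mathbb{C}$ be a primitive $m$th root of unity and $C_m$ the cyclic group of order $m$ with fixed generator $g$. $W=G(m,1,n)=S_n\ltimes (C_m)^n$; $s_{ij}\in S_n$ is the transposition of $i$ and $j$, and $g_i^l$ is the element of $(C_m)^n$ with $g^l$ in position $i$ and $1$ elsewhere. The reflection representation $V$ has basis $y_1,\dots,y_n$ with $g_i(y_i)=\eta y_i$, $g_i(y_j)=y_j$ for $j\neq i$, and $\sigma(y_j)=y_{\sigma(j)}$ for $\sigma\in S_n$. Let $x_1,\dots,x_n$ be the dual basis of $V^*$. Let $R=\mathbb{C}[\underline{t},\underline{\kappa},\underline{c}_1,\dots,\underline{c}_{m-1}]$ be a polynomial ring. $H_R$ is the quotient of the smash product $T_R(V\oplus V^* )\rtimes W$ (in which $w v w^{-1}=w(v)$; $T_R$ is the tensor algebra over $R$)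 by the relations $[x_i,x_j]=0$, $[y_i,y_j]=0$ for all $i,j$; $$[y_i,x_i]=\underline{t}-\underline{\kappa}\sum_{l=0}^{m-1}\sum_{j\neq i}s_{ij}g_i^{-l}g_j^l-\sum_{l=1}^{m-1}\underline{c}_l(1-\eta^{-l})g_i^l,$$ and, for $i\neq j$, $[y_i,x_j]=\underline{\kappa}\sum_{l=0}^{m-1}\eta^{-l}s_{ij}g_i^{-l}g_j^l$. For $c=(0;\kappa,c_1,\dots,c_{m-1})\in\mathbb{C}^{m+1}$, $H_c$ is the $\mathbb{C}$-algebra obtained from $H_R$ by specialising $\underline{t}\mapsto 0$, $\underline{\kappa}\mapsto\kappa$, $\underline{c}_l\mapsto c_l$. The Dunkl–Opdam elements are, for $1\leq i\leq n$, $$z_i=y_ix_i-\tfrac12\underline{t}+\underline{\kappa}\sum_{l=0}^{m-1}\sum_{1\leq j<i}s_{ij}g_i^lg_j^{-l}-\sum_{l=1}^{m-1}\underline{c}_l\eta^{-l}g_i^l.$$ These elements commute pairwise. *)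

theory Defs
  imports Complex_Main "HOL-Library.Poly_Mapping" "HOL-Algebra.Algebra"
    "HOL-Algebra.Elementary_Groups" "HOL-Algebra.Product_Groups"
    "HOL-Combinatorics.Combinatorics"
begin

definition primitive_root_of_unity :: "nat \<Rightarrow> complex \<Rightarrow> bool" where
  "primitive_root_of_unity m \<eta> \<longleftrightarrow> \<eta> ^ m = 1 \<and> (\<forall>k. 0 < k \<and> k < m \<longrightarrow> \<eta> ^ k \<noteq> 1)"

definition ring_commutator :: "('a, 'b) ring_scheme \<Rightarrow> 'a \<Rightarrow> 'a \<Rightarrow> 'a" where
  "ring_commutator A a b = a \<otimes>\<^bsub>A\<^esub> b \<ominus>\<^bsub>A\<^esub> b \<otimes>\<^bsub>A\<^esub> a"

definition ring_center :: "('a, 'b) ring_scheme \<Rightarrow> 'a set" where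
  "ring_center A = {z \<in> carrier A. \<forall>a \<in> carrier A. z \<otimes>\<^bsub>A\<^esub> a = a \<otimes>\<^bsub>A\<^esub> z}"


section \<open>The group $G(m,1,n)$\<close>

text \<open>
  \<^const>\<open>integer_mod_group\<close> is $C_m$ written additively, with generator $g = 1$ (which is $0$
  if $m = 1$). The pair \<open>(a, \<sigma>)\<close> stands for the product $a\sigma$ with
  $a = g_1^{a_1} \cdots g_n^{a_n}$, and $\sigma g_i \sigma^{-1} = g_{\sigma(i)}$.
\<close>

type_synonym Gm1n_elem = "(nat \<Rightarrow> int) \<times> (nat \<Rightarrow> nat)"

definition cyclic_power :: "nat \<Rightarrow> nat \<Rightarrow> (nat \<Rightarrow> int) monoid" where
  "cyclic_power m n = product_group {1..n} (\<lambda>_. integer_mod_group m)"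

definition Gm1n :: "nat \<Rightarrow> nat \<Rightarrow> Gm1n_elem monoid" where
  "Gm1n m n =
    \<lparr>carrier = carrier (cyclic_power m n) \<times> carrier (sym_group n),
     monoid.mult = (\<lambda>(a, \<sigma>) (b, \<tau>).
       (a \<otimes>\<^bsub>cyclic_power m n\<^esub> (\<lambda>k\<in>{1..n}. b (inv_into UNIV \<sigma> k)), \<sigma> \<otimes>\<^bsub>sym_group n\<^esub> \<tau>)),
     monoid.one = (\<one>\<^bsub>cyclic_power m n\<^esub>, \<one>\<^bsub>sym_group n\<^esub>)\<rparr>"

definition g_pow :: "nat \<Rightarrow> nat \<Rightarrow> nat \<Rightarrow> int \<Rightarrow> Gm1n_elem" where
  "g_pow m n i l = ((\<lambda>k\<in>{1..n}. if k = i then l mod int m else 0), \<one>\<^bsub>sym_group n\<^esub>)"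

definition transp :: "nat \<Rightarrow> nat \<Rightarrow> nat \<Rightarrow> nat \<Rightarrow> Gm1n_elem" where
  "transp m n i j = (\<one>\<^bsub>cyclic_power m n\<^esub>, transpose i j)"

text \<open>$s_{ij} g_i^{-l} g_j^l$\<close>

definition sgg :: "nat \<Rightarrow> nat \<Rightarrow> nat \<Rightarrow> nat \<Rightarrow> int \<Rightarrow> Gm1n_elem" where
  "sgg m n i j l =
    transp m n i j \<otimes>\<^bsub>Gm1n m n\<^esub> (g_pow m n i (- l) \<otimes>\<^bsub>Gm1n m n\<^esub> g_pow m n j l)"


section \<open>The coefficient ring $R$\<close>

datatype param = Par_t | Par_kappa | Par_c nat

type_synonym param_poly = "(param \<Rightarrow>\<^sub>0 nat) \<Rightarrow>\<^sub>0 complex"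

definition param_ring :: "nat \<Rightarrow> param_poly set" where
  "param_ring m =
    {p. \<forall>\<mu> \<in> Poly_Mapping.keys p.
          Poly_Mapping.keys \<mu> \<subseteq> {Par_t, Par_kappa} \<union> Par_c ` {1..<m}}"

definition par_const :: "complex \<Rightarrow> param_poly" where
  "par_const a = Poly_Mapping.single 0 a"

definition par_var :: "param \<Rightarrow> param_poly" where
  "par_var v = Poly_Mapping.single (Poly_Mapping.single v 1) 1"


section \<open>The tensor algebra $T_R(V \oplus V^*)$\<close>

text \<open>
  In the basis $x_1, \dots, x_n, y_1, \dots, y_n$ of $V \oplus V^*$ the tensor algebra is the free
  algebra, i.e. the monoid algebra over $R$ of the free monoid of words in these letters.
\<close>

datatype 'a free_monoid = Word (letters: "'a list")

instantiation free_monoid :: (type) monoid_add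
begin

definition zero_free_monoid :: "'a free_monoid" where
  "0 = Word []"

definition plus_free_monoid :: "'a free_monoid \<Rightarrow> 'a free_monoid \<Rightarrow> 'a free_monoid" where
  "u + v = Word (letters u @ letters v)"

instance
  by standard (simp_all add: zero_free_monoid_def plus_free_monoid_def)

end

datatype letter = Let_x nat | Let_y nat

type_synonym tensor = "letter free_monoid \<Rightarrow>\<^sub>0 param_poly"

definition tensor_algebra :: "nat \<Rightarrow> nat \<Rightarrow> tensor set" where
  "tensor_algebra m n =
    {f. \<forall>u \<in> Poly_Mapping.keys f. Poly_Mapping.lookup f u \<in> param_ring m
          \<and> set (letters u) \<subseteq> Let_x ` {1..n} \<union> Let_y ` {1..n}}"

definition tensor_scalar :: "param_poly \<Rightarrow> tensor" where
  "tensor_scalar p = Poly_Mapping.single 0 p"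

definition tensor_letter :: "letter \<Rightarrow> tensor" where
  "tensor_letter v = Poly_Mapping.single (Word [v]) 1"

text \<open>
  For $w = a\sigma$: $w(y_j) = \eta^{a_{\sigma(j)}} y_{\sigma(j)}$, and on the dual basis
  $w(x_j) = \eta^{-a_{\sigma(j)}} x_{\sigma(j)}$; the action is extended to $T_R(V \oplus V^*)$ by
  $R$-algebra automorphisms.
\<close>

fun letter_act :: "complex \<Rightarrow> Gm1n_elem \<Rightarrow> letter \<Rightarrow> tensor" where
  "letter_act \<eta> (a, \<sigma>) (Let_y j) =
     tensor_scalar (par_const (\<eta> powi a (\<sigma> j))) * tensor_letter (Let_y (\<sigma> j))"
| "letter_act \<eta> (a, \<sigma>) (Let_x j) =
     tensor_scalar (par_const (\<eta> powi (- a (\<sigma> j)))) * tensor_letter (Let_x (\<sigma> j))"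

definition tensor_act :: "complex \<Rightarrow> Gm1n_elem \<Rightarrow> tensor \<Rightarrow> tensor" where
  "tensor_act \<eta> w f =
    (\<Sum>u\<in>Poly_Mapping.keys f. tensor_scalar (Poly_Mapping.lookup f u)
       * prod_list (map (letter_act \<eta> w) (letters u)))"


section \<open>The smash product\<close>

text \<open>
  The smash product of a ring $A$ with a finite group $G$ acting on it by ring automorphisms
  \<open>\<alpha>\<close>: the function \<open>f\<close> stands for $\sum_{w} f(w) w$, and the product is
  determined by $(a u)(b v) = a \alpha_u(b) u v$.
\<close>

definition smash_product ::
  "'a::ring_1 set \<Rightarrow> ('g, 'c) monoid_scheme \<Rightarrow> ('g \<Rightarrow> 'a \<Rightarrow> 'a) \<Rightarrow> ('g \<Rightarrow> 'a) ring" where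
  "smash_product A G \<alpha> =
    \<lparr>carrier = {f. (\<forall>w \<in> carrier G. f w \<in> A) \<and> (\<forall>w. w \<notin> carrier G \<longrightarrow> f w = 0)},
     monoid.mult = (\<lambda>f h w. if w \<in> carrier G
       then \<Sum>u\<in>carrier G. f u * \<alpha> u (h (inv\<^bsub>G\<^esub> u \<otimes>\<^bsub>G\<^esub> w)) else 0),
     monoid.one = (\<lambda>w. if w = \<one>\<^bsub>G\<^esub> then 1 else 0),
     ring.zero = (\<lambda>w. 0),
     ring.add = (\<lambda>f h w. f w + h w)\<rparr>"

definition smash_monom :: "'a::ring_1 \<Rightarrow> 'g \<Rightarrow> 'g \<Rightarrow> 'a" where
  "smash_monom a w = (\<lambda>v. if v = w then a else 0)"

type_synonym smash_elem = "Gm1n_elem \<Rightarrow> tensor"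

definition tensor_smash :: "nat \<Rightarrow> nat \<Rightarrow> complex \<Rightarrow> smash_elem ring" where
  "tensor_smash m n \<eta> = smash_product (tensor_algebra m n) (Gm1n m n) (tensor_act \<eta>)"

definition sm_x :: "nat \<Rightarrow> nat \<Rightarrow> nat \<Rightarrow> smash_elem" where
  "sm_x m n i = smash_monom (tensor_letter (Let_x i)) \<one>\<^bsub>Gm1n m n\<^esub>"

definition sm_y :: "nat \<Rightarrow> nat \<Rightarrow> nat \<Rightarrow> smash_elem" where
  "sm_y m n i = smash_monom (tensor_letter (Let_y i)) \<one>\<^bsub>Gm1n m n\<^esub>"

definition sm_grp :: "Gm1n_elem \<Rightarrow> smash_elem" where
  "sm_grp w = smash_monom 1 w"

definition sm_par :: "nat \<Rightarrow> nat \<Rightarrow> param_poly \<Rightarrow> smash_elem" where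
  "sm_par m n p = smash_monom (tensor_scalar p) \<one>\<^bsub>Gm1n m n\<^esub>"


section \<open>The generic rational Cherednik algebra $H_R$\<close>

definition yx_diag :: "nat \<Rightarrow> nat \<Rightarrow> complex \<Rightarrow> nat \<Rightarrow> smash_elem" where
  "yx_diag m n \<eta> i = (let S = tensor_smash m n \<eta> in
     sm_par m n (par_var Par_t)
     \<ominus>\<^bsub>S\<^esub> sm_par m n (par_var Par_kappa) \<otimes>\<^bsub>S\<^esub>
         (\<Oplus>\<^bsub>S\<^esub>l\<in>{0..<m}. \<Oplus>\<^bsub>S\<^esub>j\<in>{1..n} - {i}. sm_grp (sgg m n i j (int l)))
     \<ominus>\<^bsub>S\<^esub> (\<Oplus>\<^bsub>S\<^esub>l\<in>{1..<m}.
         sm_par m n (par_var (Par_c l) * par_const (1 - \<eta> powi (- int l)))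
           \<otimes>\<^bsub>S\<^esub> sm_grp (g_pow m n i (int l))))"

definition yx_offdiag :: "nat \<Rightarrow> nat \<Rightarrow> complex \<Rightarrow> nat \<Rightarrow> nat \<Rightarrow> smash_elem" where
  "yx_offdiag m n \<eta> i j = (let S = tensor_smash m n \<eta> in
     sm_par m n (par_var Par_kappa) \<otimes>\<^bsub>S\<^esub>
       (\<Oplus>\<^bsub>S\<^esub>l\<in>{0..<m}.
         sm_par m n (par_const (\<eta> powi (- int l))) \<otimes>\<^bsub>S\<^esub> sm_grp (sgg m n i j (int l))))"

definition cherednik_rels :: "nat \<Rightarrow> nat \<Rightarrow> complex \<Rightarrow> smash_elem set" where
  "cherednik_rels m n \<eta> = (let S = tensor_smash m n \<eta> in
     {ring_commutator S (sm_x m n i) (sm_x m n j) | i j. i \<in> {1..n} \<and> j \<in> {1..n}}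
   \<union> {ring_commutator S (sm_y m n i) (sm_y m n j) | i j. i \<in> {1..n} \<and> j \<in> {1..n}}
   \<union> {ring_commutator S (sm_y m n i) (sm_x m n i) \<ominus>\<^bsub>S\<^esub> yx_diag m n \<eta> i | i. i \<in> {1..n}}
   \<union> {ring_commutator S (sm_y m n i) (sm_x m n j) \<ominus>\<^bsub>S\<^esub> yx_offdiag m n \<eta> i j | i j.
        i \<in> {1..n} \<and> j \<in> {1..n} \<and> i \<noteq> j})"

definition cherednik_ideal :: "nat \<Rightarrow> nat \<Rightarrow> complex \<Rightarrow> smash_elem set" where
  "cherednik_ideal m n \<eta> = Idl\<^bsub>tensor_smash m n \<eta>\<^esub> (cherednik_rels m n \<eta>)"

definition HR :: "nat \<Rightarrow> nat \<Rightarrow> complex \<Rightarrow> smash_elem set ring" where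
  "HR m n \<eta> = tensor_smash m n \<eta> Quot cherednik_ideal m n \<eta>"

definition HR_class :: "nat \<Rightarrow> nat \<Rightarrow> complex \<Rightarrow> smash_elem \<Rightarrow> smash_elem set" where
  "HR_class m n \<eta> a = cherednik_ideal m n \<eta> +>\<^bsub>tensor_smash m n \<eta>\<^esub> a"

definition HR_x :: "nat \<Rightarrow> nat \<Rightarrow> complex \<Rightarrow> nat \<Rightarrow> smash_elem set" where
  "HR_x m n \<eta> i = HR_class m n \<eta> (sm_x m n i)"

definition HR_y :: "nat \<Rightarrow> nat \<Rightarrow> complex \<Rightarrow> nat \<Rightarrow> smash_elem set" where
  "HR_y m n \<eta> i = HR_class m n \<eta> (sm_y m n i)"

definition HR_grp :: "nat \<Rightarrow> nat \<Rightarrow> complex \<Rightarrow> Gm1n_elem \<Rightarrow> smash_elem set" where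
  "HR_grp m n \<eta> w = HR_class m n \<eta> (sm_grp w)"

definition HR_par :: "nat \<Rightarrow> nat \<Rightarrow> complex \<Rightarrow> param_poly \<Rightarrow> smash_elem set" where
  "HR_par m n \<eta> p = HR_class m n \<eta> (sm_par m n p)"

text \<open>Note that \<open>sgg m n i j (- l)\<close> is $s_{ij} g_i^l g_j^{-l}$.\<close>

definition dunkl_opdam :: "nat \<Rightarrow> nat \<Rightarrow> complex \<Rightarrow> nat \<Rightarrow> smash_elem set" where
  "dunkl_opdam m n \<eta> i = (let H = HR m n \<eta> in
     HR_y m n \<eta> i \<otimes>\<^bsub>H\<^esub> HR_x m n \<eta> i
     \<ominus>\<^bsub>H\<^esub> HR_par m n \<eta> (par_const (1/2) * par_var Par_t)
     \<oplus>\<^bsub>H\<^esub> HR_par m n \<eta> (par_var Par_kappa) \<otimes>\<^bsub>H\<^esub>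
         (\<Oplus>\<^bsub>H\<^esub>l\<in>{0..<m}. \<Oplus>\<^bsub>H\<^esub>j\<in>{1..<i}. HR_grp m n \<eta> (sgg m n i j (- int l)))
     \<ominus>\<^bsub>H\<^esub> (\<Oplus>\<^bsub>H\<^esub>l\<in>{1..<m}.
         HR_par m n \<eta> (par_var (Par_c l) * par_const (\<eta> powi (- int l)))
           \<otimes>\<^bsub>H\<^esub> HR_grp m n \<eta> (g_pow m n i (int l))))"

definition dunkl_opdam_sym :: "nat \<Rightarrow> nat \<Rightarrow> complex \<Rightarrow> nat \<Rightarrow> smash_elem set" where
  "dunkl_opdam_sym m n \<eta> r = (let H = HR m n \<eta> in
     \<Oplus>\<^bsub>H\<^esub>J\<in>{J. J \<subseteq> {1..n} \<and> card J = r}.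
       foldr (\<lambda>j p. dunkl_opdam m n \<eta> j \<otimes>\<^bsub>H\<^esub> p) (sorted_list_of_set J) \<one>\<^bsub>H\<^esub>)"


section \<open>The specialisation $H_c$ at $c = (0; \kappa, c_1, \dots, c_{m-1})$\<close>

text \<open>
  $H_c = H_R \otimes_R \mathbb{C}$, the quotient of $H_R$ by the ideal generated by the kernel
  $(\underline{t}, \underline{\kappa} - \kappa, \underline{c}_l - c_l)$ of the evaluation
  $R \to \mathbb{C}$.
\<close>

definition specialisation_ideal ::
  "nat \<Rightarrow> nat \<Rightarrow> complex \<Rightarrow> complex \<Rightarrow> (nat \<Rightarrow> complex) \<Rightarrow> smash_elem set set" where
  "specialisation_ideal m n \<eta> \<kappa> c = Idl\<^bsub>HR m n \<eta>\<^esub>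
     ({HR_par m n \<eta> (par_var Par_t), HR_par m n \<eta> (par_var Par_kappa - par_const \<kappa>)}
      \<union> {HR_par m n \<eta> (par_var (Par_c l) - par_const (c l)) | l. l \<in> {1..<m}})"

definition Hc ::
  "nat \<Rightarrow> nat \<Rightarrow> complex \<Rightarrow> complex \<Rightarrow> (nat \<Rightarrow> complex) \<Rightarrow> smash_elem set set ring" where
  "Hc m n \<eta> \<kappa> c = HR m n \<eta> Quot specialisation_ideal m n \<eta> \<kappa> c"

definition Hc_image ::
  "nat \<Rightarrow> nat \<Rightarrow> complex \<Rightarrow> complex \<Rightarrow> (nat \<Rightarrow> complex) \<Rightarrow> smash_elem set \<Rightarrow> smash_elem set set" where
  "Hc_image m n \<eta> \<kappa> c a = specialisation_ideal m n \<eta> \<kappa> c +>\<^bsub>HR m n \<eta>\<^esub> a"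

end

theory Submission
  imports Defs
begin

text \<open>
  For a set \<open>P\<close> of indices put
  $D_P(i) = y_i x_i - \frac12 t - \sum_l c_l \eta^{-l} g_i^l + \kappa \sum_{p \in P} \sum_l s_{ip} g_i^{-l} g_p^l$,
  so that $z_i = D_{\{1, \dots, i-1\}}(i)$. Every linear order of the indices gives in the same way
  a commuting family, each element being formed with the set of indices preceding it. Exchanging
  two neighbours $i, j$ changes neither the sum nor the product of their two
  elements, so the elementary symmetric functions do not depend on the order; in particular they
  commute with $S_n$. Passing $D_P(i)$ through $x_j$ or $y_j$ with $j \neq i$ inserts $j$ into
  $P$ or removes it, and passing $D_\emptyset(j)$ through them gives
  $D_{\{1, \dots, n\} - \{j\}}(j) - t$. Hence, up to a multiple of $t$, moving $\mathfrak{S}_r$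
  across $x_j$ or $y_j$ just moves $j$ from the first to the last place of the order.
\<close>

section \<open>Rings on a type as factors of a type-class ring\<close>

text \<open>Independence of the order is needed even for \<open>x 1\<close>: the natural order has 1
  in front, but crossing \<open>x 1\<close> produces the order 2, ..., n, 1. It rests on two facts.
  If \<open>i\<close> belongs to \<open>Q\<close>, then \<open>y i\<close> deletes it from
  \<open>Q\<close> and \<open>x i\<close> restores it, so \<open>y i * x i\<close> commutes with
  \<open>opdam Q j\<close>; this yields commutativity for nested sets. The sum of the reflections
  exchanging \<open>i\<close> and \<open>j\<close> carries \<open>opdam P i\<close> to
  \<open>opdam P j\<close>; this yields the exchange of neighbours. The coefficients of the cyclic
  terms are forced by the crossing of \<open>x j\<close> by its own element: there the root of unity
  in $c_l eta^{-l}$ is absorbed, and what remains cancels the part $c_l g_j^l$ of the commutator of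
  \<open>y j\<close> and \<open>x j\<close>. Centrality has to be tested on generators, so all
  \<open>x j\<close>, all \<open>y j\<close> and all of $W$ are treated, not just
  \<open>x 1\<close>. The algebra is a quotient ring with an explicit carrier, where every
  noncommutative rewriting step would demand membership proofs. The calculus is therefore done in a
  type-class ring and read off in one component of it.\<close>

text \<open>
  The product of all rings on a type is again a type, which makes type-class arithmetic available in
  each of its factors. It is only of class \<^class>\<open>ring\<close>, since all these rings may be trivial.
\<close>

typedef 'a ring_family =
  "{f :: 'a ring \<Rightarrow> 'a. \<forall>R. if Ring.ring R then f R \<in> carrier R else f R = undefined}"
  by (rule exI[of _ "\<lambda>R. if Ring.ring R then \<zero>\<^bsub>R\<^esub> else undefined"])
    (simp add: ring.ring_simprules)

setup_lifting type_definition_ring_family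

instantiation ring_family :: (type) ring
begin

lift_definition zero_ring_family :: "'a ring_family"
  is "\<lambda>R. if Ring.ring R then \<zero>\<^bsub>R\<^esub> else undefined"
  by (simp add: ring.ring_simprules)

lift_definition plus_ring_family :: "'a ring_family \<Rightarrow> 'a ring_family \<Rightarrow> 'a ring_family"
  is "\<lambda>f g R. if Ring.ring R then f R \<oplus>\<^bsub>R\<^esub> g R else undefined"
  by (simp add: ring.ring_simprules)

lift_definition uminus_ring_family :: "'a ring_family \<Rightarrow> 'a ring_family"
  is "\<lambda>f R. if Ring.ring R then \<ominus>\<^bsub>R\<^esub> f R else undefined"
  by (simp add: ring.ring_simprules)

lift_definition minus_ring_family :: "'a ring_family \<Rightarrow> 'a ring_family \<Rightarrow> 'a ring_family"
  is "\<lambda>f g R. if Ring.ring R then f R \<ominus>\<^bsub>R\<^esub> g R else undefined"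
  by (simp add: ring.ring_simprules)

lift_definition times_ring_family :: "'a ring_family \<Rightarrow> 'a ring_family \<Rightarrow> 'a ring_family"
  is "\<lambda>f g R. if Ring.ring R then f R \<otimes>\<^bsub>R\<^esub> g R else undefined"
  by (simp add: ring.ring_simprules)

instance
proof
  fix a b c :: "'a ring_family"
  show "a + b + c = a + (b + c)"
    by (transfer, rule ext) (simp add: ring.ring_simprules(7))
  show "a + b = b + a"
    by (transfer, rule ext) (simp add: ring.ring_simprules(10))
  show "0 + a = a"
    by (transfer, rule ext) (simp add: ring.ring_simprules)
  show "- a + a = 0"
    by (transfer, rule ext) (simp add: abelian_group.l_neg ring.is_abelian_group)
  show "a - b = a + - b"
    by (transfer, rule ext) (simp add: a_minus_def)
  show "a * b * c = a * (b * c)"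
    by (transfer, rule ext) (simp add: ring.ring_simprules)
  show "(a + b) * c = a * c + b * c"
    by (transfer, rule ext) (simp add: ring.ring_simprules)
  show "a * (b + c) = a * b + a * c"
    by (transfer, rule ext) (simp add: ring.ring_simprules)
qed

end

lift_definition ring_component :: "'a ring \<Rightarrow> 'a ring_family \<Rightarrow> 'a" is "\<lambda>R f. f R" .

text \<open>Extension by zero: all components but the one at \<open>R\<close> vanish, and arguments
  outside the carrier become zero. Sums and products are respected, but $1$ is not sent to a unit of
  the product; hence the element \<open>e\<close> in the calculus below.\<close>

lift_definition ring_embed :: "'a ring \<Rightarrow> 'a \<Rightarrow> 'a ring_family"
  is "\<lambda>R a S. if Ring.ring S then (if S = R \<and> a \<in> carrier R then a else \<zero>\<^bsub>S\<^esub>) else undefined"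
  by (simp add: ring.ring_simprules)

lemma ring_component_embed:
  assumes "Ring.ring R" "a \<in> carrier R"
  shows "ring_component R (ring_embed R a) = a"
  using assms by transfer simp

lemma ring_component_closed:
  assumes "Ring.ring R"
  shows "ring_component R f \<in> carrier R"
  using assms by transfer metis

lemma ring_component_mult:
  assumes "Ring.ring R"
  shows "ring_component R (f * g) = ring_component R f \<otimes>\<^bsub>R\<^esub> ring_component R g"
  using assms by transfer simp

lemma ring_embed_zero:
  "ring_embed R \<zero>\<^bsub>R\<^esub> = 0"
  by (transfer; rule ext; auto)

lemma ring_embed_add:
  assumes "Ring.ring R" "a \<in> carrier R" "b \<in> carrier R"
  shows "ring_embed R (a \<oplus>\<^bsub>R\<^esub> b) = ring_embed R a + ring_embed R b"
  using assms by (transfer; intro ext) (simp add: ring.ring_simprules)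

lemma ring_embed_minus:
  assumes "Ring.ring R" "a \<in> carrier R" "b \<in> carrier R"
  shows "ring_embed R (a \<ominus>\<^bsub>R\<^esub> b) = ring_embed R a - ring_embed R b"
  using assms by (transfer; intro ext) (simp add: ring.ring_simprules)

lemma ring_embed_mult:
  assumes "Ring.ring R" "a \<in> carrier R" "b \<in> carrier R"
  shows "ring_embed R (a \<otimes>\<^bsub>R\<^esub> b) = ring_embed R a * ring_embed R b"
  using assms by (transfer; intro ext) (simp add: ring.ring_simprules)

lemma ring_embed_finsum:
  assumes "Ring.ring R" "finite A" "\<And>i. i \<in> A \<Longrightarrow> f i \<in> carrier R"
  shows "ring_embed R (\<Oplus>\<^bsub>R\<^esub>i\<in>A. f i) = (\<Sum>i\<in>A. ring_embed R (f i))"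
proof -
  interpret Ring.ring R by fact
  from assms(2,3) show ?thesis
    by (induction A rule: finite_induct) (simp_all add: ring_embed_zero ring_embed_add Pi_def assms(1))
qed

lemma ring_embed_eq_iff:
  assumes "Ring.ring R" "a \<in> carrier R" "b \<in> carrier R"
  shows "ring_embed R a = ring_embed R b \<longleftrightarrow> a = b"
  using ring_component_embed[OF assms(1)] assms(2,3) by metis

text \<open>The embedded element is zero in every component but the one at \<open>R\<close>, and
  there the component of \<open>f\<close> lies in the carrier. So centrality in \<open>R\<close> is
  enough for commutation with arbitrary elements of the product, which the calculus asks of its
  scalars.\<close>

lemma ring_embed_central:
  assumes "Ring.ring R" "a \<in> carrier R" "\<And>b. b \<in> carrier R \<Longrightarrow> a \<otimes>\<^bsub>R\<^esub> b = b \<otimes>\<^bsub>R\<^esub> a"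
  shows "ring_embed R a * f = f * ring_embed R a"
  using assms
proof (transfer, intro ext)
  fix R :: "'a ring" and a f S
  assume "Ring.ring R" "a \<in> carrier R" "\<And>b. b \<in> carrier R \<Longrightarrow> a \<otimes>\<^bsub>R\<^esub> b = b \<otimes>\<^bsub>R\<^esub> a"
    and f: "\<forall>R :: 'a ring. if Ring.ring R then f R \<in> carrier R else f R = undefined"
  then show "(if Ring.ring S
         then (if Ring.ring S then if S = R \<and> a \<in> carrier R then a else \<zero>\<^bsub>S\<^esub> else undefined) \<otimes>\<^bsub>S\<^esub> f S
         else undefined) =
        (if Ring.ring S
         then f S \<otimes>\<^bsub>S\<^esub> (if Ring.ring S then if S = R \<and> a \<in> carrier R then a else \<zero>\<^bsub>S\<^esub> else undefined)
         else undefined)"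
    using f[rule_format, of S] by (auto simp add: ring.ring_simprules(24,25))
qed

section \<open>The group $G(m,1,n)$\<close>

lemma carrier_Gm1n:
  assumes "m \<ge> 1"
  shows "(a, \<sigma>) \<in> carrier (Gm1n m n) \<longleftrightarrow> a \<in> {1..n} \<rightarrow>\<^sub>E {0..<int m} \<and> \<sigma> permutes {1..n}"
  using assms
  by (simp add: Gm1n_def cyclic_power_def carrier_integer_mod_group sym_group_carrier)

lemma mult_Gm1n:
  "(a, \<sigma>) \<otimes>\<^bsub>Gm1n m n\<^esub> (b, \<tau>) =
    (\<lambda>k\<in>{1..n}. (a k + b (inv_into UNIV \<sigma> k)) mod int m, \<sigma> \<circ> \<tau>)"
  by (auto simp add: Gm1n_def cyclic_power_def sym_group_mult fun_eq_iff)

lemma one_Gm1n: "\<one>\<^bsub>Gm1n m n\<^esub> = (\<lambda>k\<in>{1..n}. 0, id)"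
  by (simp add: Gm1n_def cyclic_power_def sym_group_one)

lemma Gm1n_eqI:
  assumes "\<And>k. k \<in> A \<Longrightarrow> a k = b k" "\<sigma> = \<tau>"
  shows "(\<lambda>k\<in>A. a k :: int, \<sigma> :: nat \<Rightarrow> nat) = (\<lambda>k\<in>A. b k, \<tau>)"
  using assms by (auto intro: restrict_ext)

lemma finite_Gm1n: "m \<ge> 1 \<Longrightarrow> finite (carrier (Gm1n m n))"
  by (simp add: Gm1n_def cyclic_power_def carrier_integer_mod_group sym_group_def
      finite_PiE finite_permutations)

lemma group_Gm1n:
  assumes "m \<ge> 1"
  shows "group (Gm1n m n)"
proof (rule groupI)
  fix u v assume "u \<in> carrier (Gm1n m n)" "v \<in> carrier (Gm1n m n)"
  then show "u \<otimes>\<^bsub>Gm1n m n\<^esub> v \<in> carrier (Gm1n m n)"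
    using assms by (cases u, cases v) (auto simp add: carrier_Gm1n mult_Gm1n permutes_compose)
next
  show "\<one>\<^bsub>Gm1n m n\<^esub> \<in> carrier (Gm1n m n)"
    using assms by (auto simp add: one_Gm1n carrier_Gm1n permutes_id)
next
  fix u v w assume uvw: "u \<in> carrier (Gm1n m n)" "v \<in> carrier (Gm1n m n)" "w \<in> carrier (Gm1n m n)"
  obtain a \<sigma> b \<tau> c \<rho> where eq: "u = (a, \<sigma>)" "v = (b, \<tau>)" "w = (c, \<rho>)"
    by (cases u, cases v, cases w)
  have p: "\<sigma> permutes {1..n}" "\<tau> permutes {1..n}"
    using uvw assms by (simp_all add: eq carrier_Gm1n)
  have "inv_into UNIV (\<sigma> \<circ> \<tau>) = inv_into UNIV \<tau> \<circ> inv_into UNIV \<sigma>"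
    using p by (intro o_inv_distrib permutes_bij)
  then show "u \<otimes>\<^bsub>Gm1n m n\<^esub> v \<otimes>\<^bsub>Gm1n m n\<^esub> w = u \<otimes>\<^bsub>Gm1n m n\<^esub> (v \<otimes>\<^bsub>Gm1n m n\<^esub> w)"
    using permutes_in_image[OF permutes_inv[OF p(1)]]
    unfolding eq mult_Gm1n
    by (intro Gm1n_eqI) (simp_all add: mod_simps add.assoc comp_assoc)
next
  fix u assume u: "u \<in> carrier (Gm1n m n)"
  obtain a \<sigma> where u_eq: "u = (a, \<sigma>)" by (cases u)
  have a: "a \<in> {1..n} \<rightarrow>\<^sub>E {0..<int m}" using u assms u_eq by (simp add: carrier_Gm1n)
  then have "a = (\<lambda>k\<in>{1..n}. a k)" by (simp add: PiE_iff extensional_restrict)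
  then have "u = (\<lambda>k\<in>{1..n}. a k, \<sigma>)" using u_eq by simp
  moreover have "\<one>\<^bsub>Gm1n m n\<^esub> \<otimes>\<^bsub>Gm1n m n\<^esub> u = (\<lambda>k\<in>{1..n}. a k, \<sigma>)"
    unfolding one_Gm1n u_eq mult_Gm1n using a by (intro Gm1n_eqI) (auto simp add: PiE_iff)
  ultimately show "\<one>\<^bsub>Gm1n m n\<^esub> \<otimes>\<^bsub>Gm1n m n\<^esub> u = u" by simp
next
  fix u assume u: "u \<in> carrier (Gm1n m n)"
  obtain a \<sigma> where u_eq: "u = (a, \<sigma>)" by (cases u)
  \<comment> \<open>The inverse of the product of \<open>a\<close> and \<sigma> is the inverse of
    \<sigma> times the inverse of \<open>a\<close>; putting the torus part back on the left
    re-indexes the exponents by \<sigma>.\<close>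
  let ?v = "(\<lambda>k\<in>{1..n}. (- a (\<sigma> k)) mod int m, inv_into UNIV \<sigma>)"
  have p: "\<sigma> permutes {1..n}" using u assms u_eq by (simp add: carrier_Gm1n)
  have "?v \<in> carrier (Gm1n m n)"
    using assms p by (auto simp add: carrier_Gm1n permutes_inv)
  moreover have "?v \<otimes>\<^bsub>Gm1n m n\<^esub> u = \<one>\<^bsub>Gm1n m n\<^esub>"
    unfolding u_eq mult_Gm1n one_Gm1n using p
    by (intro Gm1n_eqI) (simp_all add: permutes_inv_o permutes_inv_inv mod_simps)
  ultimately show "\<exists>v\<in>carrier (Gm1n m n). v \<otimes>\<^bsub>Gm1n m n\<^esub> u = \<one>\<^bsub>Gm1n m n\<^esub>" by blast
qed

lemma g_pow_in_Gm1n: "m \<ge> 1 \<Longrightarrow> g_pow m n i l \<in> carrier (Gm1n m n)"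
  by (auto simp add: g_pow_def sym_group_one carrier_Gm1n permutes_id)

text \<open>In a pair the torus part stands to the left of the permutation. Carrying it past the
  transposition exchanges positions \<open>i\<close> and \<open>j\<close>, so the exponents appear
  with opposite signs.\<close>

lemma sgg_eq:
  assumes "i \<in> {1..n}" "j \<in> {1..n}" "i \<noteq> j"
  shows "sgg m n i j l =
    (\<lambda>k\<in>{1..n}. if k = i then l mod int m else if k = j then (- l) mod int m else 0, transpose i j)"
proof -
  have one: "\<one>\<^bsub>cyclic_power m n\<^esub> = (\<lambda>k\<in>{1..n}. 0)"
    by (simp add: cyclic_power_def)
  have inv: "inv_into UNIV (transpose i j) k = transpose i j k" for k
    by simp
  have "transpose i j k \<in> {1..n}" if "k \<in> {1..n}" for k
    using assms that by (auto simp add: transpose_def)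
  then show ?thesis
    unfolding sgg_def transp_def g_pow_def one sym_group_one mult_Gm1n
    by (intro Gm1n_eqI) (use assms in \<open>auto simp add: inv transpose_def\<close>)
qed

lemma sgg_in_Gm1n:
  assumes "m \<ge> 1" "i \<in> {1..n}" "j \<in> {1..n}" "i \<noteq> j"
  shows "sgg m n i j l \<in> carrier (Gm1n m n)"
  using assms by (auto simp add: sgg_eq carrier_Gm1n permutes_swap_id)

lemma sgg_flip:
  assumes "i \<in> {1..n}" "j \<in> {1..n}" "i \<noteq> j"
  shows "sgg m n j i l = sgg m n i j (- l)"
  unfolding sgg_eq[OF assms] sgg_eq[OF assms(2,1) assms(3)[symmetric]]
  by (intro Gm1n_eqI) (use assms in \<open>auto simp add: transpose_commute\<close>)

lemma sgg_cong_mod: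
  assumes "i \<in> {1..n}" "j \<in> {1..n}" "i \<noteq> j" "l mod int m = l' mod int m"
  shows "sgg m n i j l = sgg m n i j l'"
proof -
  have "(- l) mod int m = (- l') mod int m" using assms(4) by (metis mod_minus_cong)
  then show ?thesis
    unfolding sgg_eq[OF assms(1-3)] using assms(4) by (intro Gm1n_eqI) simp_all
qed

text \<open>Conjugation by \<sigma> relabels the two indices. Conjugation by the torus part
  \<open>a\<close> compares \<open>a\<close> with its image under the transposition, which differs
  from it only at these two indices; this shifts the exponent. The shift disappears on summing over
  all residues \<open>l\<close>.\<close>

lemma Gm1n_conj_sgg:
  assumes "m \<ge> 1" "(a, \<sigma>) \<in> carrier (Gm1n m n)" "i \<in> {1..n}" "j \<in> {1..n}" "i \<noteq> j"
  shows "(a, \<sigma>) \<otimes>\<^bsub>Gm1n m n\<^esub> sgg m n i j l =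
    sgg m n (\<sigma> i) (\<sigma> j) (l + a (\<sigma> i) - a (\<sigma> j)) \<otimes>\<^bsub>Gm1n m n\<^esub> (a, \<sigma>)"
proof -
  have p: "\<sigma> permutes {1..n}" using assms by (simp add: carrier_Gm1n)
  have ij: "\<sigma> i \<in> {1..n}" "\<sigma> j \<in> {1..n}" "\<sigma> i \<noteq> \<sigma> j"
    using assms p permutes_in_image[OF p] by (auto dest: injD[OF permutes_inj[OF p]])
  have inv_iff: "inv_into UNIV \<sigma> k = k' \<longleftrightarrow> k = \<sigma> k'" for k k'
    using permutes_inv_eq[OF p] by auto
  have perm: "\<sigma> \<circ> transpose i j = transpose (\<sigma> i) (\<sigma> j) \<circ> \<sigma>"
    using permutes_inj[OF p] by (auto simp: fun_eq_iff transpose_def dest: injD)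
  have inv_in: "inv_into UNIV \<sigma> k \<in> {1..n}" if "k \<in> {1..n}" for k
    using permutes_in_image[OF permutes_inv[OF p]] that by simp
  show ?thesis
    unfolding sgg_eq[OF assms(3-5)] sgg_eq[OF ij] mult_Gm1n
  proof (intro Gm1n_eqI perm)
    fix k assume k: "k \<in> {1..n}"
    consider "k = \<sigma> i" | "k = \<sigma> j" | "k \<noteq> \<sigma> i" "k \<noteq> \<sigma> j" by blast
    then show "(a k + (\<lambda>k\<in>{1..n}. if k = i then l mod int m
          else if k = j then - l mod int m else 0) (inv_into UNIV \<sigma> k)) mod int m =
        ((\<lambda>k\<in>{1..n}. if k = \<sigma> i then (l + a (\<sigma> i) - a (\<sigma> j)) mod int m
          else if k = \<sigma> j then - (l + a (\<sigma> i) - a (\<sigma> j)) mod int m else 0) k +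
          a (inv_into UNIV (transpose (\<sigma> i) (\<sigma> j)) k)) mod int m"
      using inv_in[OF k] ij k assms(5)
      by cases (simp_all add: inv_iff mod_simps algebra_simps)
  qed
qed

text \<open>The torus is commutative, so only the permutation has an effect.\<close>

lemma Gm1n_conj_g_pow:
  assumes "m \<ge> 1" "(a, \<sigma>) \<in> carrier (Gm1n m n)" "i \<in> {1..n}"
  shows "(a, \<sigma>) \<otimes>\<^bsub>Gm1n m n\<^esub> g_pow m n i l = g_pow m n (\<sigma> i) l \<otimes>\<^bsub>Gm1n m n\<^esub> (a, \<sigma>)"
proof -
  have p: "\<sigma> permutes {1..n}" using assms by (simp add: carrier_Gm1n)
  have inv_iff: "inv_into UNIV \<sigma> k = k' \<longleftrightarrow> k = \<sigma> k'" for k k'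
    using permutes_inv_eq[OF p] by auto
  have inv_in: "inv_into UNIV \<sigma> k \<in> {1..n}" if "k \<in> {1..n}" for k
    using permutes_in_image[OF permutes_inv[OF p]] that by simp
  show ?thesis
    unfolding g_pow_def sym_group_one mult_Gm1n
    by (intro Gm1n_eqI) (use inv_in in \<open>auto simp add: inv_iff add.commute\<close>)
qed

section \<open>Sums over residues modulo \<open>m\<close>\<close>

lemma sum_int_mod_shift:
  fixes f :: "int \<Rightarrow> 'a::comm_monoid_add"
  assumes "m \<ge> 1" "\<And>l l'. l mod int m = l' mod int m \<Longrightarrow> f l = f l'"
  shows "(\<Sum>l\<in>{0..<m}. f (int l + s)) = (\<Sum>l\<in>{0..<m}. f (int l))"
proof (rule sum.reindex_bij_witness[where i = "\<lambda>l. nat ((int l - s) mod int m)"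
      and j = "\<lambda>l. nat ((int l + s) mod int m)"])
  have m: "0 < int m" using assms(1) by simp
  fix l assume l: "l \<in> {0..<m}"
  show "nat ((int (nat ((int l + s) mod int m)) - s) mod int m) = l"
    using l m by (simp add: mod_simps)
  show "nat ((int l + s) mod int m) \<in> {0..<m}" using m by (simp add: nat_less_iff)
  show "nat ((int (nat ((int l - s) mod int m)) + s) mod int m) = l"
    using l m by (simp add: mod_simps)
  show "nat ((int l - s) mod int m) \<in> {0..<m}" using m by (simp add: nat_less_iff)
  show "f (int (nat ((int l + s) mod int m))) = f (int l + s)"
    using m by (intro assms(2)) simp
qed

lemma sum_int_mod_uminus:
  fixes f :: "int \<Rightarrow> 'a::comm_monoid_add"
  assumes "m \<ge> 1" "\<And>l l'. l mod int m = l' mod int m \<Longrightarrow> f l = f l'"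
  shows "(\<Sum>l\<in>{0..<m}. f (- int l)) = (\<Sum>l\<in>{0..<m}. f (int l))"
proof (rule sum.reindex_bij_witness[where i = "\<lambda>l. nat ((- int l) mod int m)"
      and j = "\<lambda>l. nat ((- int l) mod int m)"])
  have m: "0 < int m" using assms(1) by simp
  fix l assume l: "l \<in> {0..<m}"
  show "nat ((- int (nat ((- int l) mod int m))) mod int m) = l"
    using l m by (simp add: mod_simps)
  then show "nat ((- int (nat ((- int l) mod int m))) mod int m) = l" .
  show "nat ((- int l) mod int m) \<in> {0..<m}" using m by (simp add: nat_less_iff)
  then show "nat ((- int l) mod int m) \<in> {0..<m}" .
  show "f (int (nat ((- int l) mod int m))) = f (- int l)"
    using m by (intro assms(2)) simp
qed

lemma powi_mod:
  assumes "m \<ge> 1" "(\<eta>::complex) ^ m = 1"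
  shows "\<eta> powi (l mod int m) = \<eta> powi l"
proof -
  have nz: "\<eta> \<noteq> 0" using assms by (auto simp: zero_power)
  have "\<eta> powi l = \<eta> powi (int m * (l div int m) + l mod int m)" by simp
  also have "\<dots> = \<eta> powi (int m * (l div int m)) * \<eta> powi (l mod int m)"
    using nz by (intro power_int_add) simp
  also have "\<eta> powi (int m * (l div int m)) = 1"
    using assms by (simp add: power_int_mult)
  finally show ?thesis by simp
qed

section \<open>Elementary symmetric functions of a list\<close>

text \<open>Factors keep the order of the list, since entries need not commute. The argument
  \<open>e\<close> takes the place of the empty product, as the type has no $1$.\<close>

fun esym :: "'a::ring \<Rightarrow> nat \<Rightarrow> 'a list \<Rightarrow> 'a" where
  "esym e 0 as = e"
| "esym e (Suc r) [] = 0"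
| "esym e (Suc r) (a # as) = a * esym e r as + esym e (Suc r) as"

lemma esym_commute:
  assumes "b * e = e * b" "\<And>a. a \<in> set as \<Longrightarrow> b * a = a * b"
  shows "b * esym e r as = esym e r as * b"
  using assms
  by (induction e r as rule: esym.induct) (simp_all add: distrib_left distrib_right mult.assoc flip: mult.assoc[of b])

text \<open>Each product keeps the order of the list, so the last entry can be split off on the
  right without any commutation between \<open>a\<close> and the other entries. The hypotheses only
  make \<open>e\<close> behave like $1$ on the entries.\<close>

lemma esym_snoc:
  assumes "a * e = e * a" "\<And>b. b \<in> set bs \<Longrightarrow> b * e = b" "a * e = a"
  shows "esym e (Suc r) (bs @ [a]) = esym e r bs * a + esym e (Suc r) bs"
  using assms
proof (induction bs arbitrary: r)
  case Nil
  then show ?case by (cases r) auto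
next
  case (Cons b bs)
  show ?case
  proof (cases r)
    case 0
    then show ?thesis using Cons.IH[of 0] Cons.prems by (simp add: algebra_simps)
  next
    case (Suc r')
    then show ?thesis using Cons.IH[of r'] Cons.IH[of r] Cons.prems by (simp add: algebra_simps)
  qed
qed

text \<open>The subsets containing the smallest index and those avoiding it give the two terms of
  the recursion. Being smallest, that index heads the sorted list, hence its factor stands on the
  left.\<close>

lemma sum_subsets_eq_esym:
  assumes "sorted_wrt (<) (xs :: nat list)"
  shows "(\<Sum>J | J \<subseteq> set xs \<and> card J = r. foldr (\<lambda>j p. f j * p) (sorted_list_of_set J) e) =
    esym e r (map f xs)"
  using assms
proof (induction xs arbitrary: r)
  case Nil
  have "{J :: nat set. J \<subseteq> set [] \<and> card J = r} = (if r = 0 then {{}} else {})" by auto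
  then show ?case by (subst \<open>_ = _\<close>) (cases r; simp)
next
  case (Cons i xs)
  let ?F = "\<lambda>J. foldr (\<lambda>j p. f j * p) (sorted_list_of_set J) e"
  have less: "\<And>j. j \<in> set xs \<Longrightarrow> i < j" using Cons.prems by simp
  show ?case
  proof (cases r)
    case 0
    have "{J. J \<subseteq> set (i # xs) \<and> card J = 0} = {{}}"
      using finite_subset[of _ "set (i # xs)"] by auto
    then show ?thesis using 0 by simp
  next
    case (Suc r')
    let ?A = "{J. J \<subseteq> set xs \<and> card J = r'}" and ?B = "{J. J \<subseteq> set xs \<and> card J = Suc r'}"
    have notin: "i \<notin> J" "finite J" if "J \<subseteq> set xs" for J
      using that less finite_subset[OF that] by auto
    have split: "{J. J \<subseteq> set (i # xs) \<and> card J = r} = insert i ` ?A \<union> ?B" (is "?C = _")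
    proof
      show "?C \<subseteq> insert i ` ?A \<union> ?B"
      proof
        fix J assume J: "J \<in> ?C"
        have fin: "finite J" using J finite_subset[of J "set (i # xs)"] by auto
        show "J \<in> insert i ` ?A \<union> ?B"
        proof (cases "i \<in> J")
          case True
          then have "J = insert i (J - {i})" "J - {i} \<in> ?A" using J Suc fin by auto
          then show ?thesis by blast
        next
          case False
          then show ?thesis using J Suc by auto
        qed
      qed
      show "insert i ` ?A \<union> ?B \<subseteq> ?C" using Suc notin by auto
    qed
    have fin: "finite ?A" "finite ?B" by (auto intro: finite_subset[OF _ finite_Pow_iff[THEN iffD2, of "set xs"]])
    have "(\<Sum>J\<in>insert i ` ?A. ?F J) = (\<Sum>J\<in>?A. ?F (insert i J))"
      using notin by (intro sum.reindex[unfolded comp_def] inj_onI) (metis insert_ident mem_Collect_eq)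
    also have "\<dots> = (\<Sum>J\<in>?A. f i * ?F J)"
    proof (rule sum.cong[OF refl])
      fix J assume "J \<in> ?A"
      then have J: "J \<subseteq> set xs" by simp
      have "sorted_list_of_set (insert i J) = i # sorted_list_of_set J"
        using notin[OF J] less J
        by (intro sorted_list_of_set_unique[THEN iffD1, of "insert i J"]) auto
      then show "?F (insert i J) = f i * ?F J" by simp
    qed
    finally have 1: "(\<Sum>J\<in>insert i ` ?A. ?F J) = f i * esym e r' (map f xs)"
      using Cons by (simp flip: sum_distrib_left)
    have "insert i ` ?A \<inter> ?B = {}" using notin by auto
    then show ?thesis
      using fin 1 Cons unfolding split by (simp add: sum.union_disjoint Suc)
  qed
qed

lemma central_left_commute:
  fixes z :: "'a::semigroup_mult"
  assumes "\<And>a. z * a = a * z"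
  shows "a * (z * b) = z * (a * b)"
  using assms[of a] by (simp flip: mult.assoc)

section \<open>The Dunkl--Opdam calculus\<close>

text \<open>
  The unit \<open>e\<close> acts as an identity only on the elements below: it is going to be the image of $1$
  in a product of rings, $h$ that of $t/2$.
\<close>

locale cherednik_relations =
  fixes m n :: nat and \<eta> :: complex
    and e t h k :: "'a::ring" and c :: "nat \<Rightarrow> 'a" and q :: "complex \<Rightarrow> 'a"
    and \<gamma> :: "Gm1n_elem \<Rightarrow> 'a" and x y :: "nat \<Rightarrow> 'a"
  assumes m: "m \<ge> 1" and eta: "\<eta> ^ m = 1"
    and t_central: "t * a = a * t" and h_central: "h * a = a * h" and k_central: "k * a = a * k"
    and c_central: "l \<in> {1..<m} \<Longrightarrow> c l * a = a * c l" and q_central: "q \<alpha> * a = a * q \<alpha>"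
    and q_mult: "q \<alpha> * q \<beta> = q (\<alpha> * \<beta>)" and q_diff: "q (\<alpha> - \<beta>) = q \<alpha> - q \<beta>"
    and q_1: "q 1 = e"
    and e_gamma: "w \<in> carrier (Gm1n m n) \<Longrightarrow> e * \<gamma> w = \<gamma> w"
    and e_x: "i \<in> {1..n} \<Longrightarrow> e * x i = x i" and e_y: "i \<in> {1..n} \<Longrightarrow> e * y i = y i"
    and e_h: "e * h = h"
    and gamma_mult: "u \<in> carrier (Gm1n m n) \<Longrightarrow> w \<in> carrier (Gm1n m n) \<Longrightarrow>
      \<gamma> u * \<gamma> w = \<gamma> (u \<otimes>\<^bsub>Gm1n m n\<^esub> w)"
    and gamma_x: "(a', \<sigma>) \<in> carrier (Gm1n m n) \<Longrightarrow> i \<in> {1..n} \<Longrightarrow>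
      \<gamma> (a', \<sigma>) * x i = q (\<eta> powi (- a' (\<sigma> i))) * x (\<sigma> i) * \<gamma> (a', \<sigma>)"
    and gamma_y: "(a', \<sigma>) \<in> carrier (Gm1n m n) \<Longrightarrow> i \<in> {1..n} \<Longrightarrow>
      \<gamma> (a', \<sigma>) * y i = q (\<eta> powi (a' (\<sigma> i))) * y (\<sigma> i) * \<gamma> (a', \<sigma>)"
    and x_x: "i \<in> {1..n} \<Longrightarrow> j \<in> {1..n} \<Longrightarrow> x i * x j = x j * x i"
    and y_y: "i \<in> {1..n} \<Longrightarrow> j \<in> {1..n} \<Longrightarrow> y i * y j = y j * y i"
    and y_x_same: "i \<in> {1..n} \<Longrightarrow> y i * x i - x i * y i =
      t - k * (\<Sum>l\<in>{0..<m}. \<Sum>j\<in>{1..n} - {i}. \<gamma> (sgg m n i j (int l)))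
        - (\<Sum>l\<in>{1..<m}. c l * q (1 - \<eta> powi (- int l)) * \<gamma> (g_pow m n i (int l)))"
    and y_x_diff: "i \<in> {1..n} \<Longrightarrow> j \<in> {1..n} \<Longrightarrow> i \<noteq> j \<Longrightarrow> y i * x j - x j * y i =
      k * (\<Sum>l\<in>{0..<m}. q (\<eta> powi (- int l)) * \<gamma> (sgg m n i j (int l)))"
begin

section \<open>Equivariance of the elements \<open>opdam P i\<close> under the group\<close>

definition refl_sum :: "nat \<Rightarrow> nat \<Rightarrow> 'a" where
  "refl_sum i j = (\<Sum>l\<in>{0..<m}. \<gamma> (sgg m n i j (int l)))"

text \<open>For distinct \<open>i\<close> and \<open>j\<close>, \<open>k\<close> times this sum is
  the commutator of \<open>y i\<close> and \<open>x j\<close>.\<close>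

definition twisted_refl_sum :: "nat \<Rightarrow> nat \<Rightarrow> 'a" where
  "twisted_refl_sum i j = (\<Sum>l\<in>{0..<m}. q (\<eta> powi (- int l)) * \<gamma> (sgg m n i j (int l)))"

definition cyc_sum :: "nat \<Rightarrow> 'a" where
  "cyc_sum i = (\<Sum>l\<in>{1..<m}. c l * q (\<eta> powi (- int l)) * \<gamma> (g_pow m n i (int l)))"

definition opdam :: "nat set \<Rightarrow> nat \<Rightarrow> 'a" where
  "opdam P i = y i * x i - h - cyc_sum i + k * (\<Sum>p\<in>P. refl_sum i p)"

lemmas k_left_commute = central_left_commute[of k, OF k_central]
lemmas q_left_commute = central_left_commute[of "q \<alpha>" for \<alpha>, OF q_central]
lemmas c_left_commute = central_left_commute[of "c l" for l, OF c_central]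

lemma sum_sgg_shift:
  assumes "i \<in> {1..n}" "j \<in> {1..n}" "i \<noteq> j"
  shows "(\<Sum>l\<in>{0..<m}. \<gamma> (sgg m n i j (int l + s))) = refl_sum i j"
  unfolding refl_sum_def
  by (rule sum_int_mod_shift[OF m]) (use sgg_cong_mod[OF assms] in metis)

lemma sum_sgg_uminus:
  assumes "i \<in> {1..n}" "j \<in> {1..n}" "i \<noteq> j"
  shows "(\<Sum>l\<in>{0..<m}. \<gamma> (sgg m n i j (- int l))) = refl_sum i j"
  unfolding refl_sum_def
  by (rule sum_int_mod_uminus[OF m]) (use sgg_cong_mod[OF assms] in metis)

text \<open>Exchanging the indices replaces \<open>l\<close> by \<open>- l\<close>, and the sum runs
  over all residues.\<close>

lemma refl_sum_sym:
  assumes "i \<in> {1..n}" "j \<in> {1..n}" "i \<noteq> j"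
  shows "refl_sum j i = refl_sum i j"
  using sum_sgg_uminus[OF assms] by (simp add: refl_sum_def sgg_flip[OF assms])

lemma gamma_refl_sum:
  assumes "(a, \<sigma>) \<in> carrier (Gm1n m n)" "i \<in> {1..n}" "j \<in> {1..n}" "i \<noteq> j"
  shows "\<gamma> (a, \<sigma>) * refl_sum i j = refl_sum (\<sigma> i) (\<sigma> j) * \<gamma> (a, \<sigma>)"
proof -
  have p: "\<sigma> permutes {1..n}" using assms m by (simp add: carrier_Gm1n)
  have ij: "\<sigma> i \<in> {1..n}" "\<sigma> j \<in> {1..n}" "\<sigma> i \<noteq> \<sigma> j"
    using assms p permutes_in_image[OF p] by (auto dest: injD[OF permutes_inj[OF p]])
  have "\<gamma> (a, \<sigma>) * refl_sum i j =
      (\<Sum>l\<in>{0..<m}. \<gamma> (sgg m n (\<sigma> i) (\<sigma> j) (int l + (a (\<sigma> i) - a (\<sigma> j))))) * \<gamma> (a, \<sigma>)"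
    unfolding refl_sum_def sum_distrib_left sum_distrib_right
    using assms m ij
    by (intro sum.cong) (simp_all add: gamma_mult sgg_in_Gm1n Gm1n_conj_sgg add_diff_eq)
  then show ?thesis using sum_sgg_shift[OF ij] by simp
qed

lemma gamma_cyc_sum:
  assumes "(a, \<sigma>) \<in> carrier (Gm1n m n)" "i \<in> {1..n}"
  shows "\<gamma> (a, \<sigma>) * cyc_sum i = cyc_sum (\<sigma> i) * \<gamma> (a, \<sigma>)"
  unfolding cyc_sum_def sum_distrib_left sum_distrib_right
proof (rule sum.cong[OF refl])
  fix l assume l: "l \<in> {1..<m}"
  have "\<gamma> (a, \<sigma>) * (c l * q (\<eta> powi (- int l)) * \<gamma> (g_pow m n i (int l))) =
      c l * q (\<eta> powi (- int l)) * (\<gamma> (a, \<sigma>) * \<gamma> (g_pow m n i (int l)))"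
    by (simp add: mult.assoc c_left_commute[OF l, of "\<gamma> (a, \<sigma>)"] q_left_commute[of "\<gamma> (a, \<sigma>)"])
  also have "\<gamma> (a, \<sigma>) * \<gamma> (g_pow m n i (int l)) = \<gamma> (g_pow m n (\<sigma> i) (int l)) * \<gamma> (a, \<sigma>)"
    using assms m by (simp add: gamma_mult g_pow_in_Gm1n Gm1n_conj_g_pow)
  finally show "\<gamma> (a, \<sigma>) * (c l * q (\<eta> powi (- int l)) * \<gamma> (g_pow m n i (int l))) =
      c l * q (\<eta> powi (- int l)) * \<gamma> (g_pow m n (\<sigma> i) (int l)) * \<gamma> (a, \<sigma>)"
    by (simp add: mult.assoc)
qed

lemma gamma_y_x:
  assumes "(a, \<sigma>) \<in> carrier (Gm1n m n)" "i \<in> {1..n}"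
  shows "\<gamma> (a, \<sigma>) * (y i * x i) = y (\<sigma> i) * x (\<sigma> i) * \<gamma> (a, \<sigma>)"
proof -
  have p: "\<sigma> permutes {1..n}" using assms m by (simp add: carrier_Gm1n)
  have i: "\<sigma> i \<in> {1..n}" using assms permutes_in_image[OF p] by simp
  have nz: "\<eta> \<noteq> 0" using eta m by (auto simp: zero_power)
  let ?q = "q (\<eta> powi (a (\<sigma> i)))" and ?q' = "q (\<eta> powi (- a (\<sigma> i)))"
  \<comment> \<open>Vectors of dual bases are scaled by inverse roots of unity, so the scalars
    cancel to \<open>e\<close>, which \<open>y\<close> absorbs.\<close>
  have qq: "?q * ?q' = e"
    using nz by (simp add: q_mult q_1 flip: power_int_add)
  have "\<gamma> (a, \<sigma>) * (y i * x i) = ?q * y (\<sigma> i) * (\<gamma> (a, \<sigma>) * x i)"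
    by (simp add: gamma_y[OF assms] flip: mult.assoc)
  also have "\<dots> = ?q * ?q' * y (\<sigma> i) * x (\<sigma> i) * \<gamma> (a, \<sigma>)"
    by (simp add: gamma_x[OF assms] mult.assoc q_left_commute[of "y (\<sigma> i)"])
  finally show ?thesis unfolding qq using e_y[OF i] by simp
qed

text \<open>Equivariance holds summand by summand: torus scalars cancel in \<open>y i * x i\<close>,
  torus shifts vanish in the sums over residues, and torus elements commute with those in
  \<open>cyc_sum i\<close>. Only the permutation of the indices remains visible.\<close>

lemma gamma_opdam:
  assumes "(a, \<sigma>) \<in> carrier (Gm1n m n)" "i \<in> {1..n}" "P \<subseteq> {1..n}" "i \<notin> P"
  shows "\<gamma> (a, \<sigma>) * opdam P i = opdam (\<sigma> ` P) (\<sigma> i) * \<gamma> (a, \<sigma>)"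
proof -
  have p: "\<sigma> permutes {1..n}" using assms m by (simp add: carrier_Gm1n)
  have "\<gamma> (a, \<sigma>) * (\<Sum>p\<in>P. refl_sum i p) = (\<Sum>p\<in>P. refl_sum (\<sigma> i) (\<sigma> p)) * \<gamma> (a, \<sigma>)"
    unfolding sum_distrib_left sum_distrib_right
    using assms by (intro sum.cong refl gamma_refl_sum) auto
  also have "(\<Sum>p\<in>P. refl_sum (\<sigma> i) (\<sigma> p)) = (\<Sum>p\<in>\<sigma> ` P. refl_sum (\<sigma> i) p)"
    using permutes_inj[OF p] by (subst sum.reindex) (auto intro: inj_on_subset)
  finally have "\<gamma> (a, \<sigma>) * (k * (\<Sum>p\<in>P. refl_sum i p)) =
      k * (\<Sum>p\<in>\<sigma> ` P. refl_sum (\<sigma> i) p) * \<gamma> (a, \<sigma>)"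
    by (simp add: k_left_commute[of "\<gamma> (a, \<sigma>)"] mult.assoc)
  then show ?thesis
    unfolding opdam_def
    using gamma_y_x[OF assms(1,2)] gamma_cyc_sum[OF assms(1,2)] h_central[of "\<gamma> (a, \<sigma>)"]
    by (simp add: algebra_simps)
qed

lemma e_central: "e * a = a * e"
  using q_central[of 1] by (simp add: q_1)

lemma powi_uminus_mod: "\<eta> powi (- (l mod int m)) = \<eta> powi (- l)"
  using powi_mod[OF m eta, of l] by (simp add: power_int_minus)

lemma powi_add: "\<eta> powi a * \<eta> powi b = \<eta> powi (a + b)"
  using eta m by (subst power_int_add) (auto simp: zero_power)

section \<open>Crossing the generators \<open>x j\<close> and \<open>y j\<close>\<close>

lemma gamma_sgg_x:
  assumes "i \<in> {1..n}" "j \<in> {1..n}" "i \<noteq> j"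
  shows "\<gamma> (sgg m n i j l) * x i = q (\<eta> powi l) * x j * \<gamma> (sgg m n i j l)"
    and "\<gamma> (sgg m n i j l) * x j = q (\<eta> powi (- l)) * x i * \<gamma> (sgg m n i j l)"
    and "p \<in> {1..n} \<Longrightarrow> p \<noteq> i \<Longrightarrow> p \<noteq> j \<Longrightarrow>
      \<gamma> (sgg m n i j l) * x p = x p * \<gamma> (sgg m n i j l)"
  using gamma_x[OF sgg_in_Gm1n[OF m assms, of l, unfolded sgg_eq[OF assms]], of i]
    gamma_x[OF sgg_in_Gm1n[OF m assms, of l, unfolded sgg_eq[OF assms]], of j]
    gamma_x[OF sgg_in_Gm1n[OF m assms, of l, unfolded sgg_eq[OF assms]], of p] assms
  by (simp_all add: sgg_eq powi_uminus_mod q_1 e_x transpose_apply_other)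

lemma gamma_sgg_y:
  assumes "i \<in> {1..n}" "j \<in> {1..n}" "i \<noteq> j"
  shows "\<gamma> (sgg m n i j l) * y i = q (\<eta> powi (- l)) * y j * \<gamma> (sgg m n i j l)"
    and "\<gamma> (sgg m n i j l) * y j = q (\<eta> powi l) * y i * \<gamma> (sgg m n i j l)"
    and "p \<in> {1..n} \<Longrightarrow> p \<noteq> i \<Longrightarrow> p \<noteq> j \<Longrightarrow>
      \<gamma> (sgg m n i j l) * y p = y p * \<gamma> (sgg m n i j l)"
  using gamma_y[OF sgg_in_Gm1n[OF m assms, of l, unfolded sgg_eq[OF assms]], of i]
    gamma_y[OF sgg_in_Gm1n[OF m assms, of l, unfolded sgg_eq[OF assms]], of j]
    gamma_y[OF sgg_in_Gm1n[OF m assms, of l, unfolded sgg_eq[OF assms]], of p] assms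
  by (simp_all add: sgg_eq powi_mod[OF m eta] q_1 e_y transpose_apply_other)

text \<open>A reflection exchanges \<open>x i\<close> and \<open>x j\<close> up to a root of unity,
  and these roots are exactly the coefficients of the twisted sum. Thus the commutator of
  \<open>y i\<close> and \<open>x j\<close>, once multiplied by \<open>x i\<close>, becomes an
  untwisted sum again, of the kind that occurs in \<open>opdam\<close>.\<close>

lemma refl_sum_x:
  assumes "i \<in> {1..n}" "j \<in> {1..n}" "i \<noteq> j"
  shows "refl_sum i j * x j = x i * twisted_refl_sum i j"
    and "twisted_refl_sum i j * x i = x j * refl_sum i j"
    and "p \<in> {1..n} \<Longrightarrow> p \<noteq> i \<Longrightarrow> p \<noteq> j \<Longrightarrow> refl_sum i j * x p = x p * refl_sum i j"
proof -
  show "refl_sum i j * x j = x i * twisted_refl_sum i j"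
    by (simp add: refl_sum_def twisted_refl_sum_def sum_distrib_left sum_distrib_right
        gamma_sgg_x[OF assms] q_left_commute[of "x i"] mult.assoc)
  have "q (\<eta> powi (- l)) * \<gamma> (sgg m n i j l) * x i = x j * \<gamma> (sgg m n i j l)" for l
  proof -
    have "q (\<eta> powi (- l)) * \<gamma> (sgg m n i j l) * x i =
        q (\<eta> powi (- l)) * q (\<eta> powi l) * x j * \<gamma> (sgg m n i j l)"
      by (simp only: mult.assoc gamma_sgg_x(1)[OF assms])
    then show ?thesis by (simp add: q_mult powi_add q_1 e_x[OF assms(2)])
  qed
  then show "twisted_refl_sum i j * x i = x j * refl_sum i j"
    by (simp add: refl_sum_def twisted_refl_sum_def sum_distrib_left sum_distrib_right)
  show "refl_sum i j * x p = x p * refl_sum i j" if "p \<in> {1..n}" "p \<noteq> i" "p \<noteq> j"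
    by (simp add: refl_sum_def sum_distrib_left sum_distrib_right gamma_sgg_x(3)[OF assms that])
qed

lemma refl_sum_y:
  assumes "i \<in> {1..n}" "j \<in> {1..n}" "i \<noteq> j"
  shows "refl_sum i j * y i = y j * twisted_refl_sum i j"
    and "p \<in> {1..n} \<Longrightarrow> p \<noteq> i \<Longrightarrow> p \<noteq> j \<Longrightarrow> refl_sum i j * y p = y p * refl_sum i j"
proof -
  show "refl_sum i j * y i = y j * twisted_refl_sum i j"
    by (simp add: refl_sum_def twisted_refl_sum_def sum_distrib_left sum_distrib_right
        gamma_sgg_y[OF assms] q_left_commute[of "y j"] mult.assoc)
  show "refl_sum i j * y p = y p * refl_sum i j" if "p \<in> {1..n}" "p \<noteq> i" "p \<noteq> j"
    by (simp add: refl_sum_def sum_distrib_left sum_distrib_right gamma_sgg_y(3)[OF assms that])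
qed

lemma gamma_g_pow_x:
  assumes "i \<in> {1..n}" "p \<in> {1..n}"
  shows "\<gamma> (g_pow m n i l) * x p =
    (if p = i then q (\<eta> powi (- l)) * x p * \<gamma> (g_pow m n i l) else x p * \<gamma> (g_pow m n i l))"
  using gamma_x[OF g_pow_in_Gm1n[OF m, of n i l, unfolded g_pow_def], of p] assms
  by (simp add: g_pow_def sym_group_one powi_uminus_mod q_1 e_x)

lemma gamma_g_pow_y:
  assumes "i \<in> {1..n}" "p \<in> {1..n}"
  shows "\<gamma> (g_pow m n i l) * y p =
    (if p = i then q (\<eta> powi l) * y p * \<gamma> (g_pow m n i l) else y p * \<gamma> (g_pow m n i l))"
  using gamma_y[OF g_pow_in_Gm1n[OF m, of n i l, unfolded g_pow_def], of p] assms
  by (simp add: g_pow_def sym_group_one powi_mod[OF m eta] q_1 e_y)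

text \<open>The cyclic part of the commutator of \<open>y i\<close> and \<open>x i\<close> has
  coefficients $c_l (1 - eta^{-l})$ and so is the difference of this sum and
  \<open>cyc_sum i\<close>. Crossing \<open>x i\<close> or \<open>y i\<close> turns one of the two
  sums into the other.\<close>

definition cyc_sum_untwisted :: "nat \<Rightarrow> 'a" where
  "cyc_sum_untwisted i = (\<Sum>l\<in>{1..<m}. c l * \<gamma> (g_pow m n i (int l)))"

lemma cyc_sum_x:
  assumes "i \<in> {1..n}" "j \<in> {1..n}" "i \<noteq> j"
  shows "cyc_sum i * x j = x j * cyc_sum i"
  unfolding cyc_sum_def sum_distrib_left sum_distrib_right
proof (rule sum.cong[OF refl])
  fix l assume l: "l \<in> {1..<m}"
  show "c l * q (\<eta> powi (- int l)) * \<gamma> (g_pow m n i (int l)) * x j =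
      x j * (c l * q (\<eta> powi (- int l)) * \<gamma> (g_pow m n i (int l)))"
    using gamma_g_pow_x[OF assms(1,2)] assms(3)
    by (simp add: mult.assoc c_left_commute[OF l, of "x j"] q_left_commute[of "x j"])
qed

lemma cyc_sum_y:
  assumes "i \<in> {1..n}" "j \<in> {1..n}" "i \<noteq> j"
  shows "cyc_sum i * y j = y j * cyc_sum i"
  unfolding cyc_sum_def sum_distrib_left sum_distrib_right
proof (rule sum.cong[OF refl])
  fix l assume l: "l \<in> {1..<m}"
  show "c l * q (\<eta> powi (- int l)) * \<gamma> (g_pow m n i (int l)) * y j =
      y j * (c l * q (\<eta> powi (- int l)) * \<gamma> (g_pow m n i (int l)))"
    using gamma_g_pow_y[OF assms(1,2)] assms(3)
    by (simp add: mult.assoc c_left_commute[OF l, of "y j"] q_left_commute[of "y j"])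
qed

lemma x_cyc_sum:
  assumes "i \<in> {1..n}"
  shows "x i * cyc_sum i = cyc_sum_untwisted i * x i"
  unfolding cyc_sum_def cyc_sum_untwisted_def sum_distrib_left sum_distrib_right
proof (rule sum.cong[OF refl])
  fix l assume l: "l \<in> {1..<m}"
  show "x i * (c l * q (\<eta> powi (- int l)) * \<gamma> (g_pow m n i (int l))) =
      c l * \<gamma> (g_pow m n i (int l)) * x i"
    using gamma_g_pow_x[OF assms assms, of "int l"]
    by (simp add: mult.assoc c_left_commute[OF l, of "x i"] q_left_commute[of "x i"])
qed

lemma cyc_sum_same_y:
  assumes "i \<in> {1..n}"
  shows "cyc_sum i * y i = y i * cyc_sum_untwisted i"
  unfolding cyc_sum_def cyc_sum_untwisted_def sum_distrib_left sum_distrib_right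
proof (rule sum.cong[OF refl])
  fix l assume l: "l \<in> {1..<m}"
  let ?g = "\<gamma> (g_pow m n i (int l))"
  have "c l * q (\<eta> powi (- int l)) * ?g * y i =
      c l * (q (\<eta> powi (- int l)) * q (\<eta> powi int l) * y i) * ?g"
    using gamma_g_pow_y[OF assms assms, of "int l"] by (simp add: mult.assoc)
  also have "\<dots> = c l * y i * ?g"
    by (simp only: q_mult powi_add) (simp add: q_1 e_y[OF assms])
  also have "\<dots> = y i * (c l * ?g)"
    by (simp add: mult.assoc c_left_commute[OF l, of "y i"])
  finally show "c l * q (\<eta> powi (- int l)) * ?g * y i = y i * (c l * ?g)" .
qed

lemma y_x_commutator:
  assumes "i \<in> {1..n}"
  shows "y i * x i = x i * y i + t - k * (\<Sum>p\<in>{1..n} - {i}. refl_sum i p)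
    - (cyc_sum_untwisted i - cyc_sum i)"
proof -
  have 1: "(\<Sum>l\<in>{0..<m}. \<Sum>j\<in>{1..n} - {i}. \<gamma> (sgg m n i j (int l))) =
      (\<Sum>p\<in>{1..n} - {i}. refl_sum i p)"
    unfolding refl_sum_def by (rule sum.swap)
  have 2: "(\<Sum>l\<in>{1..<m}. c l * q (1 - \<eta> powi (- int l)) * \<gamma> (g_pow m n i (int l))) =
      cyc_sum_untwisted i - cyc_sum i"
    unfolding cyc_sum_untwisted_def cyc_sum_def sum_subtractf[symmetric]
    by (intro sum.cong)
      (simp_all add: q_diff q_1 algebra_simps e_gamma g_pow_in_Gm1n[OF m])
  show ?thesis using y_x_same[OF assms] unfolding 1 2 by (simp add: algebra_simps)
qed

lemma opdam_insert:
  assumes "finite P" "j \<notin> P"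
  shows "opdam (insert j P) i = opdam P i + k * refl_sum i j"
  using assms by (simp add: opdam_def algebra_simps)

text \<open>Moving \<open>x j\<close> across \<open>y i\<close> creates a twisted sum, which
  \<open>x i\<close> untwists into \<open>x j * (k * refl_sum i j)\<close>: precisely the term that
  inserting \<open>j\<close> adds. The other terms commute with \<open>x j\<close>, as
  \<open>j\<close> is neither \<open>i\<close> nor in \<open>P\<close>.\<close>

lemma opdam_x:
  assumes "i \<in> {1..n}" "j \<in> {1..n}" "i \<noteq> j" "P \<subseteq> {1..n}" "i \<notin> P" "j \<notin> P"
  shows "opdam P i * x j = x j * opdam (insert j P) i"
proof -
  have fin: "finite P" using assms(4) finite_subset by blast
  have "y i * x i * x j = y i * x j * x i" using x_x[OF assms(1,2)] by (simp add: mult.assoc)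
  also have "y i * x j = x j * y i + k * twisted_refl_sum i j"
    using y_x_diff[OF assms(1-3)] by (simp add: twisted_refl_sum_def algebra_simps)
  finally have 1: "y i * x i * x j = x j * (y i * x i) + x j * (k * refl_sum i j)"
    using refl_sum_x(2)[OF assms(1-3)]
    by (simp add: distrib_right mult.assoc k_left_commute[of "x j"])
  have 2: "k * (\<Sum>p\<in>P. refl_sum i p) * x j = x j * (k * (\<Sum>p\<in>P. refl_sum i p))"
    unfolding mult.assoc k_left_commute[of "x j"] sum_distrib_left sum_distrib_right
    using assms by (intro arg_cong[of _ _ "(*) k"] sum.cong refl refl_sum_x(3)[of i]) auto
  show ?thesis
    unfolding opdam_insert[OF fin assms(6)] unfolding opdam_def
    using 1 2 cyc_sum_x[OF assms(1-3)] h_central[of "x j"]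
    by (simp add: distrib_left distrib_right left_diff_distrib right_diff_distrib)
qed

text \<open>Mirror image of \<open>opdam_x\<close>: \<open>y j\<close> passes \<open>y i\<close>
  freely and meets \<open>x i\<close>, and the resulting twisted sum is untwisted by the
  \<open>y i\<close> on its left.\<close>

lemma y_opdam:
  assumes "i \<in> {1..n}" "j \<in> {1..n}" "i \<noteq> j" "P \<subseteq> {1..n}" "i \<notin> P" "j \<notin> P"
  shows "y j * opdam P i = opdam (insert j P) i * y j"
proof -
  have fin: "finite P" using assms(4) finite_subset by blast
  have "y j * (y i * x i) = y i * (y j * x i)"
    using y_y[OF assms(1,2)] by (simp flip: mult.assoc)
  also have "y j * x i = x i * y j + k * twisted_refl_sum j i"
    using y_x_diff[OF assms(2,1)] assms(3) by (simp add: twisted_refl_sum_def algebra_simps)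
  finally have 1: "y j * (y i * x i) = y i * x i * y j + k * refl_sum i j * y j"
    using refl_sum_y(1)[OF assms(2,1)] assms(3) refl_sum_sym[OF assms(1-3)]
    by (simp add: distrib_left mult.assoc k_left_commute[of "y i"])
  have 2: "k * (\<Sum>p\<in>P. refl_sum i p) * y j = y j * (k * (\<Sum>p\<in>P. refl_sum i p))"
    unfolding mult.assoc k_left_commute[of "y j"] sum_distrib_left sum_distrib_right
    using assms by (intro arg_cong[of _ _ "(*) k"] sum.cong refl refl_sum_y(2)[of i]) auto
  show ?thesis
    unfolding opdam_insert[OF fin assms(6)] unfolding opdam_def
    using 1 2 cyc_sum_y[OF assms(1-3)] h_central[of "y j"]
    by (simp add: distrib_left distrib_right left_diff_distrib right_diff_distrib)
qed

text \<open>Reordering \<open>x j * y j\<close> by the diagonal relation brings in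
  \<open>- t\<close> and the reflection sums for all other indices at once, so the empty set becomes
  the full complement of \<open>j\<close>. The untwisted cyclic sum from the relation cancels the
  one that \<open>x j\<close> makes out of \<open>cyc_sum j\<close>.\<close>

lemma x_opdam_same:
  assumes "j \<in> {1..n}"
  shows "x j * opdam {} j = (opdam ({1..n} - {j}) j - t) * x j"
proof -
  have xy: "x j * y j = y j * x j - t + k * (\<Sum>p\<in>{1..n} - {j}. refl_sum j p)
      + (cyc_sum_untwisted j - cyc_sum j)"
    using y_x_commutator[OF assms] by simp
  have "x j * (y j * x j) = x j * y j * x j" by (simp only: mult.assoc)
  also note xy
  finally have "x j * (y j * x j) = (y j * x j - t + k * (\<Sum>p\<in>{1..n} - {j}. refl_sum j p)
      + (cyc_sum_untwisted j - cyc_sum j)) * x j" .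
  then show ?thesis
    unfolding opdam_def using x_cyc_sum[OF assms] h_central[of "x j"]
    by (simp add: algebra_simps)
qed

text \<open>The same reordering of \<open>x j * y j\<close>, now inside
  \<open>y j * x j * y j\<close>; the cyclic sums cancel on the right of \<open>y j\<close>.\<close>

lemma opdam_y_same:
  assumes "j \<in> {1..n}"
  shows "opdam {} j * y j = y j * (opdam ({1..n} - {j}) j - t)"
proof -
  have "x j * y j = y j * x j - t + k * (\<Sum>p\<in>{1..n} - {j}. refl_sum j p)
      + (cyc_sum_untwisted j - cyc_sum j)"
    using y_x_commutator[OF assms] by simp
  then have "y j * x j * y j = y j * (y j * x j - t + k * (\<Sum>p\<in>{1..n} - {j}. refl_sum j p)
      + (cyc_sum_untwisted j - cyc_sum j))"
    by (simp add: mult.assoc)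
  then show ?thesis
    unfolding opdam_def using cyc_sum_same_y[OF assms] h_central[of "y j"]
    by (simp add: algebra_simps)
qed

section \<open>Commutativity for nested sets and exchange of neighbours\<close>

lemma opdam_refl:
  assumes "i \<in> {1..n}" "j \<in> {1..n}" "i \<noteq> j" "p \<in> {1..n}" "P \<subseteq> {1..n}" "p \<notin> P"
    and "transpose i j ` P = P"
  shows "refl_sum i j * opdam P p = opdam P (transpose i j p) * refl_sum i j"
  unfolding refl_sum_def sum_distrib_left sum_distrib_right
  using gamma_opdam[OF sgg_in_Gm1n[OF m assms(1-3), unfolded sgg_eq[OF assms(1-3)]] assms(4-6)]
  by (intro sum.cong) (simp_all add: sgg_eq[OF assms(1-3)] assms(7))

lemma opdam_cyc_sum:
  assumes "i \<in> {1..n}" "p \<in> {1..n}" "P \<subseteq> {1..n}" "p \<notin> P"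
  shows "cyc_sum i * opdam P p = opdam P p * cyc_sum i"
  unfolding cyc_sum_def sum_distrib_left sum_distrib_right
proof (rule sum.cong[OF refl])
  fix l assume l: "l \<in> {1..<m}"
  have "\<gamma> (g_pow m n i (int l)) * opdam P p = opdam P p * \<gamma> (g_pow m n i (int l))"
    using gamma_opdam[OF g_pow_in_Gm1n[OF m, of n i "int l", unfolded g_pow_def] assms(2-4)]
    by (simp add: g_pow_def sym_group_one)
  then show "c l * q (\<eta> powi (- int l)) * \<gamma> (g_pow m n i (int l)) * opdam P p =
      opdam P p * (c l * q (\<eta> powi (- int l)) * \<gamma> (g_pow m n i (int l)))"
    by (simp add: mult.assoc c_left_commute[OF l, of "opdam P p"] q_left_commute[of "opdam P p"])
qed

lemma transpose_image_eq:
  assumes "i \<in> P \<longleftrightarrow> j \<in> P"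
  shows "transpose i j ` P = P"
  using assms by (auto simp add: transpose_def image_iff)

text \<open>\<open>opdam Q j\<close> commutes with each summand of \<open>opdam P i\<close>.
  Crossing \<open>y i\<close> takes \<open>i\<close> out of \<open>Q\<close> and crossing
  \<open>x i\<close> puts it back; the reflections exchange \<open>i\<close> with some
  \<open>p\<close> in \<open>P\<close>, both in \<open>Q\<close>, so they fix \<open>Q\<close> and
  \<open>j\<close>; the cyclic sum involves no permutation at all.\<close>

lemma opdam_commute:
  assumes "i \<in> Q" "j \<in> {1..n}" "j \<notin> Q" "Q \<subseteq> {1..n}" "P \<subseteq> Q" "i \<notin> P"
  shows "opdam Q j * opdam P i = opdam P i * opdam Q j"
proof -
  let ?D = "opdam Q j"
  have i: "i \<in> {1..n}" "j \<noteq> i" using assms by auto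
  have Q: "insert i (Q - {i}) = Q" "Q - {i} \<subseteq> {1..n}" "j \<notin> Q - {i}" "i \<notin> Q - {i}"
    using assms by auto
  have Dy: "?D * y i = y i * opdam (Q - {i}) j"
    using y_opdam[OF assms(2) i(1,2) Q(2-4)] by (simp only: Q(1))
  have Dx: "opdam (Q - {i}) j * x i = x i * ?D"
    using opdam_x[OF assms(2) i(1,2) Q(2-4)] by (simp only: Q(1))
  have "?D * (y i * x i) = ?D * y i * x i" by (simp only: mult.assoc)
  also have "\<dots> = y i * x i * ?D" by (simp only: Dy Dx mult.assoc)
  finally have yx: "?D * (y i * x i) = y i * x i * ?D" .
  have "refl_sum i p * ?D = ?D * refl_sum i p" if p: "p \<in> P" for p
  proof -
    have ip: "p \<in> {1..n}" "i \<noteq> p" "p \<in> Q" "j \<noteq> p" using assms p by auto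
    have "transpose i p ` Q = Q" using assms(1) ip(3) by (intro transpose_image_eq) simp
    then show ?thesis
      using opdam_refl[OF i(1) ip(1,2) assms(2,4,3)] i(2) ip(4) by (simp add: transpose_def)
  qed
  then have refl: "(\<Sum>p\<in>P. refl_sum i p) * ?D = ?D * (\<Sum>p\<in>P. refl_sum i p)"
    by (simp add: sum_distrib_left sum_distrib_right)
  have k_refl: "?D * (k * (\<Sum>p\<in>P. refl_sum i p)) = k * (\<Sum>p\<in>P. refl_sum i p) * ?D"
    by (simp only: k_left_commute[of ?D] refl mult.assoc)
  show ?thesis
    unfolding opdam_def[of P i] distrib_left distrib_right left_diff_distrib right_diff_distrib
    by (simp only: yx k_refl opdam_cyc_sum[OF i(1) assms(2,4,3)] h_central[of ?D])
qed

text \<open>Both sums equal \<open>opdam P i + opdam P j + k * refl_sum i j\<close>. For the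
  products, commutativity puts the factor with the larger set on the left; the term
  \<open>refl_sum i j\<close> split off from it turns \<open>opdam P i\<close> into
  \<open>opdam P j\<close> in passing, so that \<open>opdam P j\<close> becomes a common left
  factor.\<close>

lemma opdam_swap:
  assumes "i \<in> {1..n}" "j \<in> {1..n}" "i \<noteq> j" "P \<subseteq> {1..n}" "i \<notin> P" "j \<notin> P"
  shows "opdam P i + opdam (insert i P) j = opdam P j + opdam (insert j P) i"
    and "opdam P i * opdam (insert i P) j = opdam P j * opdam (insert j P) i"
proof -
  have fin: "finite P" using assms(4) finite_subset by blast
  show "opdam P i + opdam (insert i P) j = opdam P j + opdam (insert j P) i"
    using fin assms(5,6) refl_sum_sym[OF assms(1-3)] by (simp add: opdam_insert algebra_simps)
  have "opdam P i * opdam (insert i P) j = opdam (insert i P) j * opdam P i"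
    by (rule opdam_commute[symmetric]) (use assms in auto)
  also have "\<dots> = opdam P j * opdam P i + k * (refl_sum i j * opdam P i)"
    using fin assms(5) refl_sum_sym[OF assms(1-3)]
    by (simp add: opdam_insert distrib_right mult.assoc)
  also have "refl_sum i j * opdam P i = opdam P j * refl_sum i j"
    using opdam_refl[OF assms(1-3) assms(1) assms(4,5)] transpose_image_eq[of i P j] assms(5,6)
    by simp
  also have "opdam P j * opdam P i + k * (opdam P j * refl_sum i j) = opdam P j * opdam (insert j P) i"
    using fin assms(6) by (simp add: opdam_insert distrib_left k_left_commute[of "opdam P j"])
  finally show "opdam P i * opdam (insert i P) j = opdam P j * opdam (insert j P) i" .
qed

text \<open>Every summand has a factor on which \<open>e\<close> acts as $1$. This provides the unit
  conditions of \<open>esym_snoc\<close>.\<close>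

lemma e_opdam:
  assumes "i \<in> {1..n}" "P \<subseteq> {1..n}" "i \<notin> P"
  shows "e * opdam P i = opdam P i" and "opdam P i * e = opdam P i"
proof -
  have "e * refl_sum i p = refl_sum i p" if "p \<in> P" for p
    unfolding refl_sum_def sum_distrib_left
    using that assms by (intro sum.cong refl e_gamma sgg_in_Gm1n[OF m]) auto
  then have 1: "e * (\<Sum>p\<in>P. refl_sum i p) = (\<Sum>p\<in>P. refl_sum i p)"
    by (simp add: sum_distrib_left)
  have 2: "e * cyc_sum i = cyc_sum i"
    unfolding cyc_sum_def sum_distrib_left
  proof (rule sum.cong[OF refl])
    fix l assume l: "l \<in> {1..<m}"
    show "e * (c l * q (\<eta> powi (- int l)) * \<gamma> (g_pow m n i (int l))) =
        c l * q (\<eta> powi (- int l)) * \<gamma> (g_pow m n i (int l))"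
      using e_gamma[OF g_pow_in_Gm1n[OF m, of n i "int l"]]
      by (simp add: mult.assoc c_left_commute[OF l, of e] q_left_commute[of e])
  qed
  show "e * opdam P i = opdam P i"
    unfolding opdam_def using 1 2 e_h e_y[OF assms(1)]
    by (simp add: distrib_left right_diff_distrib k_left_commute[of e] flip: mult.assoc[of e "y i"])
  then show "opdam P i * e = opdam P i" using e_central by simp
qed

section \<open>Families belonging to an order of the indices\<close>

fun opdams :: "nat set \<Rightarrow> nat list \<Rightarrow> 'a list" where
  "opdams P [] = []"
| "opdams P (i # is) = opdam P i # opdams (insert i P) is"

text \<open>The tail of a family is again such a family, started at the set of indices already
  placed. For this reason the inductions on the order run over arbitrary starting sets
  \<open>P\<close>.\<close>

lemma opdams_append: "opdams P (is @ js) = opdams P is @ opdams (P \<union> set is) js"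
  by (induction P "is" rule: opdams.induct) simp_all

lemma opdams_upt:
  assumes "a \<le> i"
  shows "opdams {a..<i} [i..<b] = map (\<lambda>j. opdam {a..<j} j) [i..<b]"
  using assms
proof (induction "b - i" arbitrary: i)
  case 0
  then show ?case by simp
next
  case (Suc d)
  have "insert i {a..<i} = {a..<Suc i}" using Suc.prems by auto
  moreover have "[i..<b] = i # [Suc i..<b]" using Suc.hyps(2) by (simp add: upt_conv_Cons)
  ultimately show ?case using Suc by simp
qed

lemma esym_Cons_cong:
  assumes "\<And>r. esym e r as = esym e r bs"
  shows "esym e r (a # as) = esym e r (a # bs)"
  using assms by (cases r) simp_all

text \<open>Unfolding the recursion twice shows that the first two entries enter only through their
  sum and their ordered product, which \<open>opdam_swap\<close> preserves. The tail sees both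
  indices in its set, whichever came first.\<close>

lemma esym_opdams_swap:
  assumes "i \<in> {1..n}" "j \<in> {1..n}" "i \<noteq> j" "P \<subseteq> {1..n}" "i \<notin> P" "j \<notin> P"
  shows "esym e r (opdams P (i # j # is)) = esym e r (opdams P (j # i # is))"
proof -
  let ?a = "opdam P i" and ?b = "opdam (insert i P) j"
  let ?a' = "opdam P j" and ?b' = "opdam (insert j P) i"
  note eqs = opdam_swap[OF assms]
  have sum: "?a * E + ?b * E = ?a' * E + ?b' * E" for E
    by (simp only: eqs(1) distrib_right[symmetric])
  have prod: "?a * (?b * E) = ?a' * (?b' * E)" for E
    by (simp only: eqs(2) mult.assoc[symmetric])
  have ins: "insert j (insert i P) = insert i (insert j P)" by blast
  let ?E = "\<lambda>r. esym e r (opdams (insert i (insert j P)) is)"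
  show ?thesis
  proof (cases r)
    case (Suc s)
    show ?thesis
    proof (cases s)
      case 0
      show ?thesis
        by (simp only: Suc 0 opdams.simps esym.simps ins sum[of e] add.assoc[symmetric])
    next
      case (Suc s')
      have "?a * (?b * ?E s' + ?E s) + (?b * ?E s + ?E r) =
          ?a * (?b * ?E s') + (?a * ?E s + ?b * ?E s) + ?E r"
        by (simp only: distrib_left add.assoc)
      also have "\<dots> = ?a' * (?b' * ?E s') + (?a' * ?E s + ?b' * ?E s) + ?E r"
        by (simp only: sum prod)
      also have "\<dots> = ?a' * (?b' * ?E s' + ?E s) + (?b' * ?E s + ?E r)"
        by (simp only: distrib_left add.assoc)
      finally show ?thesis using Suc \<open>r = Suc s\<close> by (simp add: ins)
    qed
  qed simp
qed

lemma esym_opdams_move: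
  assumes "distinct (i # is @ js)" "P \<subseteq> {1..n}" "set (i # is @ js) \<subseteq> {1..n} - P"
  shows "esym e r (opdams P (i # is @ js)) = esym e r (opdams P (is @ i # js))"
  using assms
proof (induction "is" arbitrary: P r)
  case (Cons j "is")
  have IH: "esym e r (opdams (insert j P) (i # is @ js)) = esym e r (opdams (insert j P) (is @ i # js))" for r
    using Cons.prems by (intro Cons.IH) auto
  have "esym e r (opdams P (i # j # is @ js)) = esym e r (opdams P (j # i # is @ js))"
    using Cons.prems by (intro esym_opdams_swap) auto
  also have "\<dots> = esym e r (opdams P (j # is @ i # js))"
    unfolding opdams.simps(2)[of P j] by (rule esym_Cons_cong[OF IH])
  finally show ?case by simp
qed simp

text \<open>The head of the first list occurs somewhere in the second. By induction the rest can be
  rearranged behind that head, which is then brought to its place by neighbouring exchanges.\<close>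

lemma esym_opdams_perm:
  assumes "mset is = mset js" "distinct is" "P \<subseteq> {1..n}" "set is \<subseteq> {1..n} - P"
  shows "esym e r (opdams P is) = esym e r (opdams P js)"
  using assms
proof (induction "is" arbitrary: P r js)
  case (Cons i "is")
  then obtain js1 js2 where js: "js = js1 @ i # js2"
    by (metis list.set_intros(1) mset_eq_setD split_list)
  have mset: "mset is = mset (js1 @ js2)" using Cons.prems(1) by (simp add: js)
  have set: "set is = set (js1 @ js2)" and dist: "distinct (js1 @ js2)"
    using mset_eq_setD[OF mset] mset_eq_imp_distinct_iff[OF mset] Cons.prems(2) by simp_all
  have "esym e r (opdams (insert i P) is) = esym e r (opdams (insert i P) (js1 @ js2))" for r
    using Cons.prems by (intro Cons.IH[OF mset]) auto
  then have "esym e r (opdams P (i # is)) = esym e r (opdams P (i # js1 @ js2))"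
    unfolding opdams.simps(2)[of P i] by (rule esym_Cons_cong)
  also have "\<dots> = esym e r (opdams P js)"
    unfolding js using Cons.prems set dist by (intro esym_opdams_move) auto
  finally show ?case .
qed simp

text \<open>A family started at \<open>insert j P\<close> belongs to an order with \<open>j\<close>
  before the list, one started at \<open>P\<close> to an order with \<open>j\<close> after it.
  Crossing \<open>x j\<close> switches between the two, one entry at a time.\<close>

lemma x_esym_opdams:
  assumes "j \<in> {1..n}" "distinct is" "set is \<subseteq> {1..n} - insert j P" "P \<subseteq> {1..n}" "j \<notin> P"
  shows "x j * esym e r (opdams (insert j P) is) = esym e r (opdams P is) * x j"
  using assms
proof (induction "is" arbitrary: P r)
  case Nil
  then show ?case using e_central[of "x j"] by (cases r) simp_all
next
  case (Cons i "is")
  have IH: "x j * esym e r (opdams (insert i (insert j P)) is) =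
      esym e r (opdams (insert i P) is) * x j" for r
    using Cons.IH[of "insert i P" r] Cons.prems by (auto simp add: insert_commute)
  have D: "opdam P i * x j = x j * opdam (insert j P) i"
    using Cons.prems by (intro opdam_x) auto
  show ?case
  proof (cases r)
    case 0
    then show ?thesis using e_central[of "x j"] by simp
  next
    case (Suc s)
    have "x j * (opdam (insert j P) i * esym e s (opdams (insert i (insert j P)) is)) =
        opdam P i * (x j * esym e s (opdams (insert i (insert j P)) is))"
      using D by (simp flip: mult.assoc)
    then show ?thesis using Suc IH by (simp add: distrib_left distrib_right mult.assoc)
  qed
qed

lemma esym_opdams_y:
  assumes "j \<in> {1..n}" "distinct is" "set is \<subseteq> {1..n} - insert j P" "P \<subseteq> {1..n}" "j \<notin> P"
  shows "esym e r (opdams (insert j P) is) * y j = y j * esym e r (opdams P is)"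
  using assms
proof (induction "is" arbitrary: P r)
  case Nil
  then show ?case using e_central[of "y j"] by (cases r) simp_all
next
  case (Cons i "is")
  have IH: "esym e r (opdams (insert i (insert j P)) is) * y j =
      y j * esym e r (opdams (insert i P) is)" for r
    using Cons.IH[of "insert i P" r] Cons.prems by (auto simp add: insert_commute)
  have D: "y j * opdam P i = opdam (insert j P) i * y j"
    using Cons.prems by (intro y_opdam) auto
  show ?case
  proof (cases r)
    case 0
    then show ?thesis using e_central[of "y j"] by simp
  next
    case (Suc s)
    have "opdam (insert j P) i * (y j * esym e s (opdams (insert i P) is)) =
        y j * (opdam P i * esym e s (opdams (insert i P) is))"
      using D by (simp flip: mult.assoc)
    then show ?thesis using Suc IH by (simp add: distrib_left distrib_right mult.assoc)
  qed
qed

lemma gamma_esym_opdams: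
  assumes "(a, \<sigma>) \<in> carrier (Gm1n m n)" "P \<subseteq> {1..n}" "distinct is" "set is \<subseteq> {1..n} - P"
  shows "\<gamma> (a, \<sigma>) * esym e r (opdams P is) = esym e r (opdams (\<sigma> ` P) (map \<sigma> is)) * \<gamma> (a, \<sigma>)"
  using assms(2-)
proof (induction "is" arbitrary: P r)
  case Nil
  then show ?case using e_central[of "\<gamma> (a, \<sigma>)"] by (cases r) simp_all
next
  case (Cons i "is")
  have IH: "\<gamma> (a, \<sigma>) * esym e r (opdams (insert i P) is) =
      esym e r (opdams (insert (\<sigma> i) (\<sigma> ` P)) (map \<sigma> is)) * \<gamma> (a, \<sigma>)" for r
    using Cons.IH[of "insert i P" r] Cons.prems by auto
  have D: "\<gamma> (a, \<sigma>) * opdam P i = opdam (\<sigma> ` P) (\<sigma> i) * \<gamma> (a, \<sigma>)"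
    using Cons.prems by (intro gamma_opdam[OF assms(1)]) auto
  show ?case
  proof (cases r)
    case 0
    then show ?thesis using e_central[of "\<gamma> (a, \<sigma>)"] by simp
  next
    case (Suc s)
    have "\<gamma> (a, \<sigma>) * (opdam P i * esym e s (opdams (insert i P) is)) =
        opdam (\<sigma> ` P) (\<sigma> i) * (\<gamma> (a, \<sigma>) * esym e s (opdams (insert i P) is))"
      using D by (simp flip: mult.assoc)
    then show ?thesis using Suc IH by (simp add: distrib_left distrib_right mult.assoc)
  qed
qed

section \<open>Commutators of the elementary symmetric functions with the generators\<close>

definition opdam_esym :: "nat \<Rightarrow> 'a" where
  "opdam_esym r = esym e r (map (\<lambda>i. opdam {1..<i} i) [1..<Suc n])"

lemma opdam_esym_eq:
  assumes "distinct is" "set is = {1..n}"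
  shows "opdam_esym r = esym e r (opdams {} is)"
proof -
  have set: "set [1..<Suc n] = {1..n}"
    by (simp only: set_upt atLeastLessThanSuc_atLeastAtMost)
  have "{1..<1::nat} = {}" by simp
  then have "opdam_esym r = esym e r (opdams {} [1..<Suc n])"
    unfolding opdam_esym_def using opdams_upt[OF order_refl, of 1 "Suc n"] by (simp only:)
  also have "\<dots> = esym e r (opdams {} is)"
  proof (rule esym_opdams_perm)
    show "mset [1..<Suc n] = mset is"
      using set_eq_iff_mset_eq_distinct[OF distinct_upt assms(1), of 1 "Suc n"] set assms(2)
      by (simp only: simp_thms)
  qed (simp_all only: set distinct_upt Diff_empty empty_subsetI order_refl)
  finally show ?thesis .
qed

text \<open>A group element carries the family of the natural order to that of the permuted order,
  which has the same elementary symmetric functions.\<close>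

lemma gamma_opdam_esym:
  assumes "(a, \<sigma>) \<in> carrier (Gm1n m n)"
  shows "\<gamma> (a, \<sigma>) * opdam_esym r = opdam_esym r * \<gamma> (a, \<sigma>)"
proof -
  have p: "\<sigma> permutes {1..n}" using assms m by (simp add: carrier_Gm1n)
  have s: "set [1..<Suc n] = {1..n}"
    by (simp only: set_upt atLeastLessThanSuc_atLeastAtMost)
  have "distinct (map \<sigma> [1..<Suc n])" "set (map \<sigma> [1..<Suc n]) = {1..n}"
    unfolding distinct_map list.set_map s
    using permutes_inj[OF p] permutes_image[OF p] by (auto intro: inj_on_subset)
  then show ?thesis
    using gamma_esym_opdams[OF assms, of "{}" "[1..<Suc n]" r] opdam_esym_eq[OF distinct_upt s, of r]
      opdam_esym_eq[of "map \<sigma> [1..<Suc n]" r]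
    by (simp only: s distinct_upt image_empty empty_subsetI Diff_empty order_refl simp_thms)
qed

text \<open>
  Moving \<open>j\<close> from the front to the end of the order turns \<open>opdam {} j\<close> into
  \<open>opdam ({1..n} - {j}) j\<close>, which is also what passing through \<open>x j\<close> or \<open>y j\<close>
  produces, up to \<open>t\<close>.
\<close>

lemma opdam_esym_split:
  assumes "j \<in> {1..n}"
  obtains "is" where "distinct is" "set is = {1..n} - {j}"
    and "opdam_esym (Suc r) =
      opdam {} j * esym e r (opdams {j} is) + esym e (Suc r) (opdams {j} is)"
    and "opdam_esym (Suc r) =
      opdam ({1..n} - {j}) j * esym e r (opdams {} is) + esym e (Suc r) (opdams {} is)"
    and "opdam ({1..n} - {j}) j * esym e r (opdams {} is) =
      esym e r (opdams {} is) * opdam ({1..n} - {j}) j"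
proof -
  obtain js where js: "distinct js" "set js = {1..n} - {j}"
    using finite_distinct_list[of "{1..n} - {j}"] by auto
  have j: "{1..n} - {j} \<subseteq> {1..n}" "j \<notin> {1..n} - {j}" by auto
  \<comment> \<open>The set of the last index contains every other index, so
    \<open>opdam_commute\<close> applies to each entry. The starting set \<open>P\<close> is
    arbitrary, since it grows along the list.\<close>
  have commute: "opdam ({1..n} - {j}) j * b = b * opdam ({1..n} - {j}) j \<and> b * e = b"
    if "set is \<subseteq> {1..n} - insert j P" "distinct is" "P \<subseteq> {1..n} - {j}"
      "b \<in> set (opdams P is)" for b P "is"
    using that
  proof (induction "is" arbitrary: P)
    case (Cons i "is")
    then consider "b = opdam P i" | "b \<in> set (opdams (insert i P) is)" by auto
    then show ?case
    proof cases
      case 1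
      have "opdam ({1..n} - {j}) j * opdam P i = opdam P i * opdam ({1..n} - {j}) j"
        using Cons.prems assms by (intro opdam_commute) auto
      moreover have "opdam P i * e = opdam P i"
        using Cons.prems by (intro e_opdam(2)) auto
      ultimately show ?thesis using 1 by simp
    next
      case 2
      then show ?thesis using Cons.prems by (intro Cons.IH[of "insert i P"]) auto
    qed
  qed simp
  have comm: "opdam ({1..n} - {j}) j * b = b * opdam ({1..n} - {j}) j" "b * e = b"
    if "b \<in> set (opdams {} js)" for b
    using commute[OF _ js(1) _ that] js(2) by simp_all
  \<comment> \<open>\<open>esym_snoc\<close> leaves the last factor on the right; this brings it to
    the left.\<close>
  have 3: "opdam ({1..n} - {j}) j * esym e r (opdams {} js) =
      esym e r (opdams {} js) * opdam ({1..n} - {j}) j"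
    by (rule esym_commute[OF e_central[symmetric] comm(1)])
  have "distinct (j # js)" "set (j # js) = {1..n}"
    using js insert_Diff[OF assms] by simp_all
  from opdam_esym_eq[OF this] have 1: "opdam_esym (Suc r) =
      opdam {} j * esym e r (opdams {j} js) + esym e (Suc r) (opdams {j} js)" by simp
  have "distinct (js @ [j])" "set (js @ [j]) = {1..n}"
    using js insert_Diff[OF assms] by simp_all
  from opdam_esym_eq[OF this]
  have "opdam_esym (Suc r) = esym e (Suc r) (opdams {} (js @ [j]))" .
  also have "opdams {} (js @ [j]) = opdams {} js @ [opdam ({1..n} - {j}) j]"
    by (simp add: opdams_append js(2))
  also have "esym e (Suc r) \<dots> = esym e r (opdams {} js) * opdam ({1..n} - {j}) j + esym e (Suc r) (opdams {} js)"
    by (rule esym_snoc[OF e_central[symmetric] comm(2) e_opdam(2)[OF assms j]])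
  finally have 2: "opdam_esym (Suc r) =
      opdam ({1..n} - {j}) j * esym e r (opdams {} js) + esym e (Suc r) (opdams {} js)"
    by (simp only: 3)
  show ?thesis using that[OF js 1 2 3] .
qed

lemma x_opdam_esym:
  assumes "j \<in> {1..n}"
  shows "\<exists>f. x j * opdam_esym (Suc r) - opdam_esym (Suc r) * x j = t * f"
proof -
  obtain "is" where js: "distinct is" "set is = {1..n} - {j}"
    and 1: "opdam_esym (Suc r) =
      opdam {} j * esym e r (opdams {j} is) + esym e (Suc r) (opdams {j} is)"
    and 2: "opdam_esym (Suc r) =
      opdam ({1..n} - {j}) j * esym e r (opdams {} is) + esym e (Suc r) (opdams {} is)"
    using opdam_esym_split[OF assms] by metis
  have pass: "x j * esym e r (opdams {j} is) = esym e r (opdams {} is) * x j" for r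
    using x_esym_opdams[OF assms js(1), of "{}" r] js(2) by simp
  have "x j * opdam_esym (Suc r) =
      x j * opdam {} j * esym e r (opdams {j} is) + x j * esym e (Suc r) (opdams {j} is)"
    unfolding 1 by (simp add: distrib_left mult.assoc)
  also have "\<dots> = (opdam ({1..n} - {j}) j - t) * (x j * esym e r (opdams {j} is))
      + x j * esym e (Suc r) (opdams {j} is)"
    unfolding x_opdam_same[OF assms] by (simp add: mult.assoc)
  \<comment> \<open>Without its \<open>t\<close> the sum is the expansion of
    \<open>opdam_esym (Suc r)\<close> with \<open>j\<close> in last place, followed by
    \<open>x j\<close>.\<close>
  also have "\<dots> = opdam_esym (Suc r) * x j - t * (esym e r (opdams {} is) * x j)"
    unfolding pass 2 by (simp add: algebra_simps)
  finally have "x j * opdam_esym (Suc r) - opdam_esym (Suc r) * x j =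
      t * (- (esym e r (opdams {} is) * x j))" by simp
  then show ?thesis by blast
qed

lemma y_opdam_esym:
  assumes "j \<in> {1..n}"
  shows "\<exists>f. y j * opdam_esym (Suc r) - opdam_esym (Suc r) * y j = t * f"
proof -
  obtain "is" where js: "distinct is" "set is = {1..n} - {j}"
    and 1: "opdam_esym (Suc r) =
      opdam {} j * esym e r (opdams {j} is) + esym e (Suc r) (opdams {j} is)"
    and 2: "opdam_esym (Suc r) =
      opdam ({1..n} - {j}) j * esym e r (opdams {} is) + esym e (Suc r) (opdams {} is)"
    using opdam_esym_split[OF assms] by metis
  have pass: "esym e r (opdams {j} is) * y j = y j * esym e r (opdams {} is)" for r
    using esym_opdams_y[OF assms js(1), of "{}" r] js(2) by simp
  have "opdam_esym (Suc r) * y j =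
      opdam {} j * y j * esym e r (opdams {} is) + y j * esym e (Suc r) (opdams {} is)"
    unfolding 1 by (simp add: distrib_right mult.assoc pass)
  also have "\<dots> = y j * opdam_esym (Suc r) - y j * t * esym e r (opdams {} is)"
    unfolding opdam_y_same[OF assms] 2 by (simp add: algebra_simps)
  also have "y j * t * esym e r (opdams {} is) = t * (y j * esym e r (opdams {} is))"
    using t_central[of "y j"] by (simp add: mult.assoc[symmetric])
  finally have "y j * opdam_esym (Suc r) - opdam_esym (Suc r) * y j =
      t * (y j * esym e r (opdams {} is))" by simp
  then show ?thesis by blast
qed

end

section \<open>The tensor algebra\<close>

lemma poly_mapping_eq_sum_single:
  "f = (\<Sum>u\<in>Poly_Mapping.keys f. Poly_Mapping.single u (Poly_Mapping.lookup f u))"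
proof (rule poly_mapping_eqI)
  fix v
  show "Poly_Mapping.lookup f v = Poly_Mapping.lookup
      (\<Sum>u\<in>Poly_Mapping.keys f. Poly_Mapping.single u (Poly_Mapping.lookup f u)) v"
    by (cases "v \<in> Poly_Mapping.keys f")
      (auto simp add: lookup_sum lookup_single when_def sum.delta' in_keys_iff)
qed

lemma param_ring_0: "0 \<in> param_ring m" by (simp add: param_ring_def)

lemma param_ring_const: "par_const a \<in> param_ring m"
  by (simp add: param_ring_def par_const_def)

lemma param_ring_1: "1 \<in> param_ring m"
  by (simp add: param_ring_def)

lemma param_ring_var: "v \<in> {Par_t, Par_kappa} \<union> Par_c ` {1..<m} \<Longrightarrow> par_var v \<in> param_ring m"
  by (simp add: param_ring_def par_var_def)

lemma param_ring_add: "p \<in> param_ring m \<Longrightarrow> q \<in> param_ring m \<Longrightarrow> p + q \<in> param_ring m"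
  unfolding param_ring_def using keys_add[of p q] by blast

lemma param_ring_uminus: "p \<in> param_ring m \<Longrightarrow> - p \<in> param_ring m"
  by (simp add: param_ring_def in_keys_iff)

lemma param_ring_diff: "p \<in> param_ring m \<Longrightarrow> q \<in> param_ring m \<Longrightarrow> p - q \<in> param_ring m"
  using param_ring_add[of p m "- q"] param_ring_uminus[of q m] by simp

lemma param_ring_mult: "p \<in> param_ring m \<Longrightarrow> q \<in> param_ring m \<Longrightarrow> p * q \<in> param_ring m"
  unfolding param_ring_def
proof (intro CollectI ballI subsetI)
  fix \<mu> v
  assume p: "p \<in> {p. \<forall>\<mu>\<in>Poly_Mapping.keys p.
      Poly_Mapping.keys \<mu> \<subseteq> {Par_t, Par_kappa} \<union> Par_c ` {1..<m}}"
    and q: "q \<in> {p. \<forall>\<mu>\<in>Poly_Mapping.keys p.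
      Poly_Mapping.keys \<mu> \<subseteq> {Par_t, Par_kappa} \<union> Par_c ` {1..<m}}"
    and \<mu>: "\<mu> \<in> Poly_Mapping.keys (p * q)" and v: "v \<in> Poly_Mapping.keys \<mu>"
  obtain \<alpha> \<beta> where "\<mu> = \<alpha> + \<beta>" "\<alpha> \<in> Poly_Mapping.keys p" "\<beta> \<in> Poly_Mapping.keys q"
    using \<mu> keys_mult[of p q] by blast
  then show "v \<in> {Par_t, Par_kappa} \<union> Par_c ` {1..<m}"
    using p q v keys_add[of \<alpha> \<beta>] by blast
qed

lemma par_const_mult: "par_const a * par_const b = par_const (a * b)"
  by (simp add: par_const_def mult_single)

lemma par_const_diff: "par_const (a - b) = par_const a - par_const b"
  by (simp add: par_const_def single_diff)

lemma par_const_1: "par_const 1 = 1"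
  by (simp add: par_const_def)

definition algebra_letters :: "nat \<Rightarrow> letter set" where
  "algebra_letters n = Let_x ` {1..n} \<union> Let_y ` {1..n}"

lemma tensor_algebra_iff:
  "f \<in> tensor_algebra m n \<longleftrightarrow> (\<forall>u. Poly_Mapping.lookup f u \<in> param_ring m \<and>
    (Poly_Mapping.lookup f u \<noteq> 0 \<longrightarrow> set (letters u) \<subseteq> algebra_letters n))"
  unfolding tensor_algebra_def algebra_letters_def mem_Collect_eq Ball_def in_keys_iff
  using param_ring_0 by metis

lemma tensor_algebra_lookup:
  "f \<in> tensor_algebra m n \<Longrightarrow> Poly_Mapping.lookup f u \<in> param_ring m"
  by (simp add: tensor_algebra_iff)

lemma tensor_algebra_keys:
  "f \<in> tensor_algebra m n \<Longrightarrow> u \<in> Poly_Mapping.keys f \<Longrightarrow> set (letters u) \<subseteq> algebra_letters n"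
  unfolding tensor_algebra_iff in_keys_iff by blast

lemma tensor_algebra_0: "0 \<in> tensor_algebra m n"
  by (simp add: tensor_algebra_iff param_ring_0)

lemma tensor_algebra_add:
  "f \<in> tensor_algebra m n \<Longrightarrow> g \<in> tensor_algebra m n \<Longrightarrow> f + g \<in> tensor_algebra m n"
  unfolding tensor_algebra_iff lookup_add using param_ring_add by (metis add_0)

lemma tensor_algebra_uminus:
  "f \<in> tensor_algebra m n \<Longrightarrow> - f \<in> tensor_algebra m n"
  by (simp add: tensor_algebra_iff param_ring_uminus)

lemma tensor_algebra_sum:
  "(\<And>i. i \<in> I \<Longrightarrow> f i \<in> tensor_algebra m n) \<Longrightarrow> (\<Sum>i\<in>I. f i) \<in> tensor_algebra m n"
  by (induction I rule: infinite_finite_induct)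
    (simp_all add: tensor_algebra_0 tensor_algebra_add)

lemma tensor_algebra_single:
  assumes "p \<in> param_ring m" "set (letters u) \<subseteq> algebra_letters n"
  shows "Poly_Mapping.single u p \<in> tensor_algebra m n"
  using assms by (simp add: tensor_algebra_iff lookup_single when_def param_ring_0)

lemma tensor_algebra_scalar: "p \<in> param_ring m \<Longrightarrow> tensor_scalar p \<in> tensor_algebra m n"
  by (simp add: tensor_scalar_def tensor_algebra_single zero_free_monoid_def)

lemma tensor_algebra_letter: "v \<in> algebra_letters n \<Longrightarrow> tensor_letter v \<in> tensor_algebra m n"
  by (simp add: tensor_letter_def tensor_algebra_single param_ring_1)

lemma tensor_algebra_mult:
  assumes "f \<in> tensor_algebra m n" "g \<in> tensor_algebra m n"
  shows "f * g \<in> tensor_algebra m n"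
proof -
  have "f * g = (\<Sum>u\<in>Poly_Mapping.keys f. \<Sum>v\<in>Poly_Mapping.keys g.
      Poly_Mapping.single (u + v) (Poly_Mapping.lookup f u * Poly_Mapping.lookup g v))"
    by (subst poly_mapping_eq_sum_single[of f], subst poly_mapping_eq_sum_single[of g])
      (simp add: sum_product mult_single)
  moreover have "\<dots> \<in> tensor_algebra m n"
  proof (intro tensor_algebra_sum tensor_algebra_single param_ring_mult)
    fix u v assume "u \<in> Poly_Mapping.keys f" "v \<in> Poly_Mapping.keys g"
    then have "set (letters u) \<subseteq> algebra_letters n" "set (letters v) \<subseteq> algebra_letters n"
      using assms tensor_algebra_keys by blast+
    then show "set (letters (u + v)) \<subseteq> algebra_letters n"
      by (simp add: plus_free_monoid_def)
  qed (use assms in \<open>simp_all only: tensor_algebra_lookup\<close>)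
  ultimately show ?thesis by (simp only:)
qed

lemma tensor_scalar_1: "tensor_scalar 1 = 1"
  by (simp add: tensor_scalar_def)

lemma tensor_algebra_1: "1 \<in> tensor_algebra m n"
  using tensor_algebra_scalar[OF param_ring_1] by (simp add: tensor_scalar_1)

lemma tensor_scalar_0: "tensor_scalar 0 = 0"
  by (simp add: tensor_scalar_def)

lemma tensor_scalar_add: "tensor_scalar (p + q) = tensor_scalar p + tensor_scalar q"
  by (simp add: tensor_scalar_def single_add)

lemma tensor_scalar_mult: "tensor_scalar (p * q) = tensor_scalar p * tensor_scalar q"
  by (simp add: tensor_scalar_def mult_single)

lemma tensor_scalar_central: "tensor_scalar p * f = f * tensor_scalar p"
  unfolding tensor_scalar_def
  by (subst (1 2) poly_mapping_eq_sum_single[of f])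
    (simp add: sum_distrib_left sum_distrib_right mult_single mult.commute)

lemma prod_list_tensor_letter:
  "prod_list (map tensor_letter vs) = Poly_Mapping.single (Word vs) 1"
  by (induction vs) (simp_all add: tensor_letter_def mult_single plus_free_monoid_def
      zero_free_monoid_def flip: single_one)

lemma single_eq_scalar_mult:
  "Poly_Mapping.single u p = tensor_scalar p * prod_list (map tensor_letter (letters u))"
  by (simp add: prod_list_tensor_letter tensor_scalar_def mult_single)

text \<open>Every element is a finite sum of scalars times words, so the subring is generated by its
  scalars and letters. Statements about the group action thereby reduce to letters.\<close>

lemma tensor_algebra_induct [consumes 1, case_names scalar letter add mult]:
  assumes "f \<in> tensor_algebra m n"
    and "\<And>p. p \<in> param_ring m \<Longrightarrow> P (tensor_scalar p)"
    and "\<And>v. v \<in> algebra_letters n \<Longrightarrow> P (tensor_letter v)"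
    and "\<And>f g. f \<in> tensor_algebra m n \<Longrightarrow> g \<in> tensor_algebra m n \<Longrightarrow> P f \<Longrightarrow> P g \<Longrightarrow> P (f + g)"
    and "\<And>f g. f \<in> tensor_algebra m n \<Longrightarrow> g \<in> tensor_algebra m n \<Longrightarrow> P f \<Longrightarrow> P g \<Longrightarrow> P (f * g)"
  shows "P f"
proof -
  have word: "P (prod_list (map tensor_letter vs)) \<and>
      prod_list (map tensor_letter vs) \<in> tensor_algebra m n"
    if "set vs \<subseteq> algebra_letters n" for vs
    using that assms(2)[OF param_ring_1]
    by (induction vs)
      (simp_all add: tensor_scalar_1 tensor_algebra_1 tensor_algebra_letter tensor_algebra_mult
        assms(3,5))
  have single: "P (Poly_Mapping.single u (Poly_Mapping.lookup f u))"
    if "u \<in> Poly_Mapping.keys f" for u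
    unfolding single_eq_scalar_mult
    using word[OF tensor_algebra_keys[OF assms(1) that]] tensor_algebra_lookup[OF assms(1), of u]
    by (simp only: assms(2,5) tensor_algebra_scalar)
  have "P (\<Sum>u\<in>U. Poly_Mapping.single u (Poly_Mapping.lookup f u)) \<and>
      (\<Sum>u\<in>U. Poly_Mapping.single u (Poly_Mapping.lookup f u)) \<in> tensor_algebra m n"
    if "finite U" "U \<subseteq> Poly_Mapping.keys f" for U
    using that
  proof (induction U rule: finite_induct)
    case empty
    then show ?case using assms(2)[OF param_ring_0] by (simp add: tensor_scalar_0 tensor_algebra_0)
  next
    case (insert u U)
    have "Poly_Mapping.single u (Poly_Mapping.lookup f u) \<in> tensor_algebra m n"
      using insert.prems assms(1)
      by (intro tensor_algebra_single tensor_algebra_lookup[OF assms(1)] tensor_algebra_keys[OF assms(1)]) simp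
    then show ?case using insert by (simp add: assms(4) single tensor_algebra_add)
  qed
  from this[OF finite_keys order_refl] show ?thesis
    using poly_mapping_eq_sum_single[of f] by simp
qed

section \<open>The action of the group on the tensor algebra\<close>

lemma tensor_act_superset:
  assumes "finite U" "Poly_Mapping.keys f \<subseteq> U"
  shows "tensor_act \<eta> w f = (\<Sum>u\<in>U. tensor_scalar (Poly_Mapping.lookup f u)
       * prod_list (map (letter_act \<eta> w) (letters u)))"
  unfolding tensor_act_def
  using assms by (intro sum.mono_neutral_left) (auto simp add: in_keys_iff tensor_scalar_0)

lemma tensor_act_add: "tensor_act \<eta> w (f + g) = tensor_act \<eta> w f + tensor_act \<eta> w g"
proof -
  let ?U = "Poly_Mapping.keys f \<union> Poly_Mapping.keys g"
  have U: "finite ?U" "Poly_Mapping.keys (f + g) \<subseteq> ?U" "Poly_Mapping.keys f \<subseteq> ?U"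
    "Poly_Mapping.keys g \<subseteq> ?U"
    using keys_add[of f g] by auto
  show ?thesis
    unfolding tensor_act_superset[OF U(1,2)] tensor_act_superset[OF U(1,3)]
      tensor_act_superset[OF U(1,4)]
    by (simp add: lookup_add tensor_scalar_add distrib_right sum.distrib)
qed

lemma tensor_act_0: "tensor_act \<eta> w 0 = 0"
  by (simp add: tensor_act_def)

lemma tensor_act_sum: "tensor_act \<eta> w (\<Sum>i\<in>I. f i) = (\<Sum>i\<in>I. tensor_act \<eta> w (f i))"
  by (induction I rule: infinite_finite_induct) (simp_all add: tensor_act_0 tensor_act_add)

lemma tensor_act_single:
  "tensor_act \<eta> w (Poly_Mapping.single u p) =
    tensor_scalar p * prod_list (map (letter_act \<eta> w) (letters u))"
  by (subst tensor_act_superset[of "{u}"]) simp_all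

text \<open>On words the action is multiplicative by construction. The scalar of the second factor
  passes the image of the first word because scalars are central.\<close>

lemma tensor_act_mult: "tensor_act \<eta> w (f * g) = tensor_act \<eta> w f * tensor_act \<eta> w g"
proof -
  have single: "tensor_act \<eta> w (Poly_Mapping.single u p * Poly_Mapping.single v q) =
      tensor_act \<eta> w (Poly_Mapping.single u p) * tensor_act \<eta> w (Poly_Mapping.single v q)" for u v p q
  proof -
    let ?L = "\<lambda>u. prod_list (map (letter_act \<eta> w) (letters u))"
    have "tensor_scalar p * ?L u * (tensor_scalar q * ?L v) =
        tensor_scalar p * (?L u * tensor_scalar q) * ?L v"
      by (simp only: mult.assoc)
    also have "\<dots> = tensor_scalar p * tensor_scalar q * (?L u * ?L v)"
      by (simp only: tensor_scalar_central[of q "?L u", symmetric] mult.assoc)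
    finally show ?thesis
      by (simp add: mult_single tensor_act_single tensor_scalar_mult plus_free_monoid_def)
  qed
  show ?thesis
    by (subst (1 2) poly_mapping_eq_sum_single[of f], subst (1 2) poly_mapping_eq_sum_single[of g])
      (simp only: sum_product tensor_act_sum single)
qed

lemma tensor_act_scalar: "tensor_act \<eta> w (tensor_scalar p) = tensor_scalar p"
  by (simp add: tensor_scalar_def[of p] tensor_act_single zero_free_monoid_def)

lemma tensor_act_letter: "tensor_act \<eta> w (tensor_letter v) = letter_act \<eta> w v"
  by (simp add: tensor_letter_def tensor_act_single tensor_scalar_1)

lemma letter_act_closed:
  assumes "m \<ge> 1" "w \<in> carrier (Gm1n m n)" "v \<in> algebra_letters n"
  shows "letter_act \<eta> w v \<in> tensor_algebra m n"
proof -
  obtain a \<sigma> where w: "w = (a, \<sigma>)" by (cases w)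
  have p: "\<sigma> permutes {1..n}" using assms by (simp add: w carrier_Gm1n)
  obtain j where j: "j \<in> {1..n}" "v = Let_x j \<or> v = Let_y j"
    using assms(3) by (auto simp only: algebra_letters_def)
  have "\<sigma> j \<in> {1..n}" using permutes_in_image[OF p] j(1) by blast
  then have "Let_x (\<sigma> j) \<in> algebra_letters n" "Let_y (\<sigma> j) \<in> algebra_letters n"
    by (simp_all only: algebra_letters_def Un_iff imageI simp_thms)
  then show ?thesis
    using j(2) unfolding w
    by (elim disjE)
      (simp_all only: letter_act.simps tensor_algebra_mult tensor_algebra_scalar
        tensor_algebra_letter param_ring_const)
qed

lemma tensor_act_closed:
  assumes "m \<ge> 1" "w \<in> carrier (Gm1n m n)" "f \<in> tensor_algebra m n"
  shows "tensor_act \<eta> w f \<in> tensor_algebra m n"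
  using assms(3)
  by (induction rule: tensor_algebra_induct)
    (simp_all add: tensor_act_scalar tensor_act_letter tensor_act_add tensor_act_mult
      tensor_algebra_scalar tensor_algebra_add tensor_algebra_mult letter_act_closed[OF assms(1,2)])

lemma tensor_act_id:
  assumes "f \<in> tensor_algebra m n"
  shows "tensor_act \<eta> \<one>\<^bsub>Gm1n m n\<^esub> f = f"
  using assms
proof (induction rule: tensor_algebra_induct)
  case (letter v)
  then show ?case
    by (auto simp add: tensor_act_letter one_Gm1n algebra_letters_def par_const_1 tensor_scalar_1)
qed (simp_all add: tensor_act_scalar tensor_act_add tensor_act_mult)

text \<open>Both sides are multiplicative and fix scalars, which leaves the letters. On a letter the
  two exponents of \<eta> add up, and reducing the sum modulo \<open>m\<close> is harmless because
  \<open>\<eta> ^ m = 1\<close>.\<close>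

lemma tensor_act_compose:
  assumes "m \<ge> 1" "\<eta> ^ m = 1" "u \<in> carrier (Gm1n m n)" "w \<in> carrier (Gm1n m n)"
    and "f \<in> tensor_algebra m n"
  shows "tensor_act \<eta> u (tensor_act \<eta> w f) = tensor_act \<eta> (u \<otimes>\<^bsub>Gm1n m n\<^esub> w) f"
  using assms(5)
proof (induction rule: tensor_algebra_induct)
  case (letter v)
  obtain a \<sigma> b \<tau> where eq: "u = (a, \<sigma>)" "w = (b, \<tau>)" by (cases u, cases w)
  have p: "\<sigma> permutes {1..n}" "\<tau> permutes {1..n}" using assms by (simp_all add: eq carrier_Gm1n)
  have nz: "\<eta> \<noteq> 0" using assms by (auto simp: zero_power)
  obtain j where j: "j \<in> {1..n}" "v = Let_x j \<or> v = Let_y j"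
    using letter by (auto simp only: algebra_letters_def)
  have in_range: "\<sigma> (\<tau> j) \<in> {1..n}"
    using j(1) permutes_in_image[OF p(1)] permutes_in_image[OF p(2)] by blast
  have inv: "inv_into UNIV \<sigma> (\<sigma> (\<tau> j)) = \<tau> j"
    using permutes_inverses(2)[OF p(1)] by simp
  have pos: "\<eta> powi ((s + s') mod int m) = \<eta> powi s' * \<eta> powi s" for s s'
    using powi_mod[OF assms(1,2), of "s + s'"] nz by (simp add: power_int_add)
  then have neg: "\<eta> powi (- ((s + s') mod int m)) = \<eta> powi (- s') * \<eta> powi (- s)" for s s'
    by (simp add: power_int_minus)
  show ?case
    using j(2)
  proof
    assume "v = Let_x j"
    then show ?thesis
      using in_range
      by (simp add: eq tensor_act_letter tensor_act_mult tensor_act_scalar mult_Gm1n inv neg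
          flip: par_const_mult tensor_scalar_mult mult.assoc)
  next
    assume "v = Let_y j"
    then show ?thesis
      using in_range
      by (simp add: eq tensor_act_letter tensor_act_mult tensor_act_scalar mult_Gm1n inv pos
          flip: par_const_mult tensor_scalar_mult mult.assoc)
  qed
qed (simp_all add: tensor_act_scalar tensor_act_add tensor_act_mult)

section \<open>Smash products\<close>

text \<open>Additivity and multiplicativity are asked on the whole type, where the tensor action has
  them. The identity and composition laws are asked on \<open>A\<close> only, since exponents of a
  group element are not prescribed at indices outside the range.\<close>

locale ring_action =
  fixes A :: "'a::ring_1 set" and G :: "('g, 'c) monoid_scheme" (structure)
    and \<alpha> :: "'g \<Rightarrow> 'a \<Rightarrow> 'a"
  assumes group: "group G" and finite: "finite (carrier G)"
    and A_zero: "0 \<in> A" and A_one: "1 \<in> A"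
    and A_add: "a \<in> A \<Longrightarrow> b \<in> A \<Longrightarrow> a + b \<in> A" and A_uminus: "a \<in> A \<Longrightarrow> - a \<in> A"
    and A_mult: "a \<in> A \<Longrightarrow> b \<in> A \<Longrightarrow> a * b \<in> A"
    and act_closed: "u \<in> carrier G \<Longrightarrow> a \<in> A \<Longrightarrow> \<alpha> u a \<in> A"
    and act_add: "\<alpha> u (a + b) = \<alpha> u a + \<alpha> u b"
    and act_mult: "\<alpha> u (a * b) = \<alpha> u a * \<alpha> u b"
    and act_1: "\<alpha> u 1 = 1"
    and act_id: "a \<in> A \<Longrightarrow> \<alpha> \<one> a = a"
    and act_compose: "u \<in> carrier G \<Longrightarrow> v \<in> carrier G \<Longrightarrow> a \<in> A \<Longrightarrow>
      \<alpha> u (\<alpha> v a) = \<alpha> (u \<otimes> v) a"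
begin

interpretation group G by (rule group)

abbreviation S where "S \<equiv> smash_product A G \<alpha>"

lemma act_0: "\<alpha> u 0 = 0"
  using act_add[of u 0 0] by simp

lemma act_sum: "\<alpha> u (\<Sum>i\<in>I. f i) = (\<Sum>i\<in>I. \<alpha> u (f i))"
  by (induction I rule: infinite_finite_induct) (simp_all add: act_0 act_add)

lemma A_sum: "(\<And>i. i \<in> I \<Longrightarrow> f i \<in> A) \<Longrightarrow> (\<Sum>i\<in>I. f i) \<in> A"
  by (induction I rule: infinite_finite_induct) (simp_all add: A_zero A_add)

lemma smash_carrier:
  "f \<in> carrier S \<longleftrightarrow> (\<forall>w \<in> carrier G. f w \<in> A) \<and> (\<forall>w. w \<notin> carrier G \<longrightarrow> f w = 0)"
  by (simp add: smash_product_def)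

lemma smash_mult:
  "f \<otimes>\<^bsub>S\<^esub> g = (\<lambda>w. if w \<in> carrier G then \<Sum>u\<in>carrier G. f u * \<alpha> u (g (inv u \<otimes> w)) else 0)"
  by (simp add: smash_product_def)

lemma smash_add: "f \<oplus>\<^bsub>S\<^esub> g = (\<lambda>w. f w + g w)"
  by (simp add: smash_product_def)

lemma smash_zero: "\<zero>\<^bsub>S\<^esub> = (\<lambda>w. 0)"
  by (simp add: smash_product_def)

lemma smash_one: "\<one>\<^bsub>S\<^esub> = smash_monom 1 \<one>"
  by (simp add: smash_product_def smash_monom_def)

lemma smash_mult_closed:
  assumes "f \<in> carrier S" "g \<in> carrier S"
  shows "f \<otimes>\<^bsub>S\<^esub> g \<in> carrier S"
  using assms unfolding smash_carrier smash_mult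
  by (simp add: A_sum A_mult act_closed)

lemma smash_mult_assoc:
  assumes f: "f \<in> carrier S" and g: "g \<in> carrier S" and h: "h \<in> carrier S"
  shows "f \<otimes>\<^bsub>S\<^esub> g \<otimes>\<^bsub>S\<^esub> h = f \<otimes>\<^bsub>S\<^esub> (g \<otimes>\<^bsub>S\<^esub> h)"
proof
  fix w
  show "(f \<otimes>\<^bsub>S\<^esub> g \<otimes>\<^bsub>S\<^esub> h) w = (f \<otimes>\<^bsub>S\<^esub> (g \<otimes>\<^bsub>S\<^esub> h)) w"
  proof (cases "w \<in> carrier G")
    case w: True
    have hA: "h (inv u \<otimes> v) \<in> A" if "u \<in> carrier G" "v \<in> carrier G" for u v
      using h that by (simp add: smash_carrier)
    have "(f \<otimes>\<^bsub>S\<^esub> g \<otimes>\<^bsub>S\<^esub> h) w =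
        (\<Sum>u\<in>carrier G. \<Sum>v\<in>carrier G. f v * \<alpha> v (g (inv v \<otimes> u)) * \<alpha> u (h (inv u \<otimes> w)))"
      using w by (simp add: smash_mult sum_distrib_right)
    also have "\<dots> =
        (\<Sum>v\<in>carrier G. \<Sum>u\<in>carrier G. f v * \<alpha> v (g (inv v \<otimes> u)) * \<alpha> u (h (inv u \<otimes> w)))"
      by (rule sum.swap)
    also have "\<dots> = (\<Sum>v\<in>carrier G. \<Sum>u\<in>carrier G.
        f v * \<alpha> v (g u) * \<alpha> (v \<otimes> u) (h (inv u \<otimes> (inv v \<otimes> w))))"
    proof (rule sum.cong[OF refl])
      fix v assume v: "v \<in> carrier G"
      \<comment> \<open>The inner variable is the product of the group elements taken from
        \<open>f\<close> and \<open>g\<close>; the substitution divides out the one from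
        \<open>f\<close>.\<close>
      show "(\<Sum>u\<in>carrier G. f v * \<alpha> v (g (inv v \<otimes> u)) * \<alpha> u (h (inv u \<otimes> w))) =
        (\<Sum>u\<in>carrier G. f v * \<alpha> v (g u) * \<alpha> (v \<otimes> u) (h (inv u \<otimes> (inv v \<otimes> w))))"
        by (rule sum.reindex_bij_witness[where i = "\<lambda>u. v \<otimes> u" and j = "\<lambda>u. inv v \<otimes> u"])
          (use v w in \<open>simp_all add: inv_solve_left' inv_mult_group m_assoc flip: m_assoc[of v "inv v"] m_assoc[of "inv v" v]\<close>)
    qed
    also have "\<dots> = (\<Sum>v\<in>carrier G. \<Sum>u\<in>carrier G.
        f v * (\<alpha> v (g u) * \<alpha> v (\<alpha> u (h (inv u \<otimes> (inv v \<otimes> w))))))"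
      using w by (intro sum.cong refl) (simp add: act_compose hA mult.assoc)
    also have "\<dots> = (f \<otimes>\<^bsub>S\<^esub> (g \<otimes>\<^bsub>S\<^esub> h)) w"
      using w by (simp add: smash_mult act_sum act_mult sum_distrib_left)
    finally show ?thesis .
  qed (simp add: smash_mult)
qed

lemma smash_monom_closed: "a \<in> A \<Longrightarrow> w \<in> carrier G \<Longrightarrow> smash_monom a w \<in> carrier S"
  by (auto simp add: smash_carrier smash_monom_def A_zero)

lemma smash_monom_mult_left:
  assumes "u \<in> carrier G" "w \<in> carrier G"
  shows "(smash_monom a u \<otimes>\<^bsub>S\<^esub> f) w = a * \<alpha> u (f (inv u \<otimes> w))"
  using assms finite
  by (simp add: smash_mult smash_monom_def if_distrib[of "\<lambda>b. b * _"] cong: if_cong)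

lemma smash_monom_mult:
  assumes "u \<in> carrier G" "v \<in> carrier G"
  shows "smash_monom a u \<otimes>\<^bsub>S\<^esub> smash_monom b v = smash_monom (a * \<alpha> u b) (u \<otimes> v)"
proof
  fix w
  show "(smash_monom a u \<otimes>\<^bsub>S\<^esub> smash_monom b v) w = smash_monom (a * \<alpha> u b) (u \<otimes> v) w"
  proof (cases "w \<in> carrier G")
    case True
    then have "inv u \<otimes> w = v \<longleftrightarrow> w = u \<otimes> v"
      using assms by (metis inv_solve_left)
    then show ?thesis
      using assms True by (simp add: smash_monom_mult_left) (simp add: smash_monom_def act_0)
  next
    case False
    then show ?thesis using assms by (auto simp add: smash_mult smash_monom_def)
  qed
qed

lemma smash_l_one:
  assumes "f \<in> carrier S"
  shows "\<one>\<^bsub>S\<^esub> \<otimes>\<^bsub>S\<^esub> f = f"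
proof
  fix w
  show "(\<one>\<^bsub>S\<^esub> \<otimes>\<^bsub>S\<^esub> f) w = f w"
  proof (cases "w \<in> carrier G")
    case True
    then show ?thesis using assms
      by (simp add: smash_one smash_monom_mult_left act_id smash_carrier)
  next
    case False
    then show ?thesis using assms by (simp add: smash_mult smash_carrier)
  qed
qed

lemma smash_monom_one_mult_right:
  assumes "w \<in> carrier G"
  shows "(f \<otimes>\<^bsub>S\<^esub> smash_monom a \<one>) w = f w * \<alpha> w a"
proof -
  have "f u * \<alpha> u (smash_monom a \<one> (inv u \<otimes> w)) = (if u = w then f u * \<alpha> w a else 0)"
    if "u \<in> carrier G" for u
  proof -
    have "inv u \<otimes> w = \<one> \<longleftrightarrow> u = w" using that assms by (metis inv_solve_left r_one one_closed)
    then show ?thesis by (simp add: smash_monom_def act_0)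
  qed
  then show ?thesis using assms finite by (simp add: smash_mult)
qed

lemma smash_r_one:
  assumes "f \<in> carrier S"
  shows "f \<otimes>\<^bsub>S\<^esub> \<one>\<^bsub>S\<^esub> = f"
proof
  fix w
  show "(f \<otimes>\<^bsub>S\<^esub> \<one>\<^bsub>S\<^esub>) w = f w"
  proof (cases "w \<in> carrier G")
    case True
    then show ?thesis by (simp add: smash_one smash_monom_one_mult_right act_1)
  next
    case False
    then show ?thesis using assms by (simp add: smash_mult smash_carrier)
  qed
qed

lemma smash_one_closed: "\<one>\<^bsub>S\<^esub> \<in> carrier S"
  by (simp add: smash_one smash_monom_closed A_one)

lemma smash_monom_central:
  assumes "f \<in> carrier S" "\<And>b. b \<in> A \<Longrightarrow> a * b = b * a" "\<And>u. u \<in> carrier G \<Longrightarrow> \<alpha> u a = a"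
  shows "smash_monom a \<one> \<otimes>\<^bsub>S\<^esub> f = f \<otimes>\<^bsub>S\<^esub> smash_monom a \<one>"
proof
  fix w
  show "(smash_monom a \<one> \<otimes>\<^bsub>S\<^esub> f) w = (f \<otimes>\<^bsub>S\<^esub> smash_monom a \<one>) w"
  proof (cases "w \<in> carrier G")
    case True
    then show ?thesis
      using assms
      by (simp add: smash_monom_mult_left smash_monom_one_mult_right smash_carrier act_id)
  qed (simp add: smash_mult)
qed

lemma smash_abelian_group: "abelian_group S"
proof (rule abelian_groupI)
  fix f assume "f \<in> carrier S"
  then show "\<exists>g\<in>carrier S. g \<oplus>\<^bsub>S\<^esub> f = \<zero>\<^bsub>S\<^esub>"
    by (intro bexI[of _ "\<lambda>w. - f w"]) (simp_all add: smash_carrier smash_add smash_zero A_uminus)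
qed (auto simp add: smash_carrier smash_add smash_zero A_zero A_add add_ac)

lemma smash_ring: "Ring.ring S"
proof (rule ringI)
  show "Group.monoid S"
    by (rule monoidI) (simp_all add: smash_mult_closed smash_mult_assoc smash_l_one smash_r_one
        smash_one_closed)
qed (simp_all add: smash_abelian_group smash_mult smash_add distrib_left distrib_right act_add
    sum.distrib fun_eq_iff)

lemma smash_finsum:
  assumes "finite I" "\<And>i. i \<in> I \<Longrightarrow> F i \<in> carrier S"
  shows "(\<Oplus>\<^bsub>S\<^esub>i\<in>I. F i) = (\<lambda>w. \<Sum>i\<in>I. F i w)"
proof -
  interpret abelian_group S by (rule smash_abelian_group)
  show ?thesis
    using assms
    by (induction I rule: finite_induct) (auto simp add: smash_zero smash_add)
qed

lemma smash_expand:
  assumes "f \<in> carrier S"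
  shows "f = (\<Oplus>\<^bsub>S\<^esub>w\<in>carrier G. smash_monom (f w) w)"
proof -
  have "(\<Oplus>\<^bsub>S\<^esub>w\<in>carrier G. smash_monom (f w) w) = (\<lambda>v. \<Sum>w\<in>carrier G. smash_monom (f w) w v)"
    using assms by (intro smash_finsum finite smash_monom_closed) (auto simp add: smash_carrier)
  also have "\<dots> = f"
    using assms finite by (auto simp add: smash_monom_def smash_carrier fun_eq_iff)
  finally show ?thesis by simp
qed

end

lemma tensor_ring_action:
  assumes "m \<ge> 1" "\<eta> ^ m = 1"
  shows "ring_action (tensor_algebra m n) (Gm1n m n) (tensor_act \<eta>)"
  using assms
  by (intro ring_action.intro)
    (simp_all add: group_Gm1n finite_Gm1n tensor_algebra_0 tensor_algebra_1 tensor_algebra_add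
      tensor_algebra_uminus tensor_algebra_mult tensor_act_closed tensor_act_add tensor_act_mult
      tensor_act_id tensor_act_compose tensor_act_scalar[of _ _ 1, unfolded tensor_scalar_1])

section \<open>The generic rational Cherednik algebra\<close>

locale cherednik =
  fixes m n :: nat and \<eta> :: complex
  assumes m: "m \<ge> 1" and eta: "\<eta> ^ m = 1"
begin

abbreviation "A \<equiv> tensor_algebra m n"
abbreviation "G \<equiv> Gm1n m n"
abbreviation "S \<equiv> tensor_smash m n \<eta>"
abbreviation "H \<equiv> HR m n \<eta>"

sublocale action: ring_action A G "tensor_act \<eta>"
  by (rule tensor_ring_action[OF m eta])

lemma S_eq: "smash_product A G (tensor_act \<eta>) = S"
  by (simp add: tensor_smash_def)

sublocale G: group G by (rule group_Gm1n[OF m])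

sublocale S: Ring.ring S
  using action.smash_ring by (simp add: S_eq)

lemmas smash_monom_closed = action.smash_monom_closed[unfolded S_eq]
lemmas smash_monom_mult = action.smash_monom_mult[unfolded S_eq]

lemma letters_closed:
  assumes "i \<in> {1..n}"
  shows "tensor_letter (Let_x i) \<in> A" "tensor_letter (Let_y i) \<in> A"
  using assms by (auto intro!: tensor_algebra_letter simp only: algebra_letters_def)

lemma sm_x_closed: "i \<in> {1..n} \<Longrightarrow> sm_x m n i \<in> carrier S"
  and sm_y_closed: "i \<in> {1..n} \<Longrightarrow> sm_y m n i \<in> carrier S"
  unfolding sm_x_def sm_y_def by (simp_all only: smash_monom_closed letters_closed G.one_closed)

lemma sm_grp_closed: "w \<in> carrier G \<Longrightarrow> sm_grp w \<in> carrier S"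
  by (simp add: sm_grp_def smash_monom_closed tensor_algebra_1)

lemma sm_par_closed: "p \<in> param_ring m \<Longrightarrow> sm_par m n p \<in> carrier S"
  by (simp add: sm_par_def smash_monom_closed tensor_algebra_scalar)

lemma par_closed:
  shows "par_var Par_t \<in> param_ring m" "par_var Par_kappa \<in> param_ring m"
    and "l \<in> {1..<m} \<Longrightarrow> par_var (Par_c l) \<in> param_ring m"
  by (auto intro: param_ring_var)

lemma sm_par_mult: "sm_par m n (p * q) = sm_par m n p \<otimes>\<^bsub>S\<^esub> sm_par m n q"
  by (simp add: sm_par_def smash_monom_mult tensor_act_scalar tensor_scalar_mult)

lemma sm_par_add: "sm_par m n (p + q) = sm_par m n p \<oplus>\<^bsub>S\<^esub> sm_par m n q"
  by (auto simp add: sm_par_def action.smash_add[unfolded S_eq] smash_monom_def tensor_scalar_add)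

lemma sm_par_0: "sm_par m n 0 = \<zero>\<^bsub>S\<^esub>"
  by (auto simp add: sm_par_def action.smash_zero[unfolded S_eq] smash_monom_def tensor_scalar_0)

lemma sm_par_1: "sm_par m n 1 = \<one>\<^bsub>S\<^esub>"
  by (simp add: sm_par_def action.smash_one[unfolded S_eq] tensor_scalar_1)

lemma sm_par_central:
  "f \<in> carrier S \<Longrightarrow> sm_par m n p \<otimes>\<^bsub>S\<^esub> f = f \<otimes>\<^bsub>S\<^esub> sm_par m n p"
  unfolding sm_par_def
  by (rule action.smash_monom_central[unfolded S_eq])
    (simp_all add: tensor_scalar_central tensor_act_scalar)

lemma sm_grp_mult:
  "u \<in> carrier G \<Longrightarrow> w \<in> carrier G \<Longrightarrow> sm_grp u \<otimes>\<^bsub>S\<^esub> sm_grp w = sm_grp (u \<otimes>\<^bsub>G\<^esub> w)"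
  by (simp add: sm_grp_def smash_monom_mult action.act_1)

lemma sm_grp_letter:
  assumes "w \<in> carrier G" "tensor_letter v \<in> A"
    and "letter_act \<eta> w v = tensor_scalar p * tensor_letter v'" "tensor_letter v' \<in> A"
  shows "sm_grp w \<otimes>\<^bsub>S\<^esub> smash_monom (tensor_letter v) \<one>\<^bsub>G\<^esub> =
    sm_par m n p \<otimes>\<^bsub>S\<^esub> smash_monom (tensor_letter v') \<one>\<^bsub>G\<^esub> \<otimes>\<^bsub>S\<^esub> sm_grp w"
  using assms
  by (simp add: sm_grp_def sm_par_def smash_monom_mult tensor_act_letter[of \<eta> w v]
      action.act_id action.act_1)

lemma sgg_closed: "i \<in> {1..n} \<Longrightarrow> j \<in> {1..n} - {i} \<Longrightarrow> sgg m n i j l \<in> carrier G"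
  by (rule sgg_in_Gm1n[OF m]) auto

lemma g_pow_closed: "g_pow m n i l \<in> carrier G"
  by (rule g_pow_in_Gm1n[OF m])

lemma yx_diag_closed: "i \<in> {1..n} \<Longrightarrow> yx_diag m n \<eta> i \<in> carrier S"
  unfolding yx_diag_def Let_def
  by (intro S.minus_closed S.m_closed S.finsum_closed Pi_I sm_par_closed sm_grp_closed sgg_closed
      g_pow_closed par_closed param_ring_mult param_ring_const) simp_all

lemma yx_offdiag_closed:
  "i \<in> {1..n} \<Longrightarrow> j \<in> {1..n} - {i} \<Longrightarrow> yx_offdiag m n \<eta> i j \<in> carrier S"
  unfolding yx_offdiag_def Let_def
  by (intro S.m_closed S.finsum_closed Pi_I sm_par_closed sm_grp_closed sgg_closed
      par_closed param_ring_const) simp_all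

lemma commutator_closed:
  "a \<in> carrier S \<Longrightarrow> b \<in> carrier S \<Longrightarrow> ring_commutator S a b \<in> carrier S"
  by (simp add: ring_commutator_def)

lemma cherednik_rels_closed: "cherednik_rels m n \<eta> \<subseteq> carrier S"
  unfolding cherednik_rels_def Let_def
  using commutator_closed sm_x_closed sm_y_closed yx_diag_closed yx_offdiag_closed
  by (auto intro!: S.minus_closed)

sublocale I: ideal "cherednik_ideal m n \<eta>" S
  unfolding cherednik_ideal_def by (rule S.genideal_ideal[OF cherednik_rels_closed])

sublocale H: Ring.ring H
  unfolding HR_def by (rule I.quotient_is_ring)

lemma HR_class_hom: "HR_class m n \<eta> \<in> ring_hom S H"
  unfolding HR_def using I.rcos_ring_hom by (simp add: HR_class_def[abs_def])

lemma HR_class_closed: "a \<in> carrier S \<Longrightarrow> HR_class m n \<eta> a \<in> carrier H"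
  by (rule ring_hom_closed[OF HR_class_hom])

lemma HR_carrier_E:
  assumes "b \<in> carrier H"
  obtains a where "a \<in> carrier S" "b = HR_class m n \<eta> a"
  using assms unfolding HR_def FactRing_def A_RCOSETS_def' HR_class_def by auto

lemma HR_class_ideal: "a \<in> cherednik_ideal m n \<eta> \<Longrightarrow> HR_class m n \<eta> a = \<zero>\<^bsub>H\<^esub>"
  unfolding HR_class_def HR_def by (simp add: FactRing_def I.a_rcos_const)

text \<open>The quotient map followed by the embedding into the product of rings: it carries the
  relations of the algebra to the type-class ring.\<close>

definition \<psi> :: "smash_elem \<Rightarrow> smash_elem set ring_family" where
  "\<psi> a = ring_embed H (HR_class m n \<eta> a)"

lemma psi_add: "a \<in> carrier S \<Longrightarrow> b \<in> carrier S \<Longrightarrow> \<psi> (a \<oplus>\<^bsub>S\<^esub> b) = \<psi> a + \<psi> b"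
  unfolding \<psi>_def
  by (simp add: ring_hom_add[OF HR_class_hom] ring_embed_add[OF H.ring_axioms] HR_class_closed)

lemma psi_mult: "a \<in> carrier S \<Longrightarrow> b \<in> carrier S \<Longrightarrow> \<psi> (a \<otimes>\<^bsub>S\<^esub> b) = \<psi> a * \<psi> b"
  unfolding \<psi>_def
  by (simp add: ring_hom_mult[OF HR_class_hom] ring_embed_mult[OF H.ring_axioms] HR_class_closed)

lemma psi_minus:
  assumes "a \<in> carrier S" "b \<in> carrier S"
  shows "\<psi> (a \<ominus>\<^bsub>S\<^esub> b) = \<psi> a - \<psi> b"
proof -
  have "a \<ominus>\<^bsub>S\<^esub> b \<oplus>\<^bsub>S\<^esub> b = a"
    using assms by (simp add: a_minus_def S.a_assoc S.l_neg)
  then show ?thesis using psi_add[of "a \<ominus>\<^bsub>S\<^esub> b" b] assms by (simp add: algebra_simps)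
qed

lemma psi_zero: "\<psi> \<zero>\<^bsub>S\<^esub> = 0"
  using psi_minus[of "\<zero>\<^bsub>S\<^esub>" "\<zero>\<^bsub>S\<^esub>"] by (simp add: a_minus_def)

lemma psi_finsum:
  assumes "finite J" "\<And>i. i \<in> J \<Longrightarrow> f i \<in> carrier S"
  shows "\<psi> (\<Oplus>\<^bsub>S\<^esub>i\<in>J. f i) = (\<Sum>i\<in>J. \<psi> (f i))"
  using assms
  by (induction J rule: finite_induct) (simp_all add: psi_zero psi_add Pi_def)

lemma psi_rel:
  assumes "a \<in> cherednik_rels m n \<eta>"
  shows "\<psi> a = 0"
proof -
  have "a \<in> cherednik_ideal m n \<eta>"
    unfolding cherednik_ideal_def using S.genideal_self[OF cherednik_rels_closed] assms by blast
  then show ?thesis by (simp add: \<psi>_def HR_class_ideal ring_embed_zero)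
qed

lemma psi_commutator:
  "a \<in> carrier S \<Longrightarrow> b \<in> carrier S \<Longrightarrow> \<psi> (ring_commutator S a b) = \<psi> a * \<psi> b - \<psi> b * \<psi> a"
  by (simp add: ring_commutator_def psi_minus psi_mult)

lemma psi_par_central:
  assumes "p \<in> param_ring m"
  shows "\<psi> (sm_par m n p) * f = f * \<psi> (sm_par m n p)"
  unfolding \<psi>_def
proof (rule ring_embed_central[OF H.ring_axioms HR_class_closed[OF sm_par_closed[OF assms]]])
  fix b assume "b \<in> carrier H"
  then obtain a where a: "a \<in> carrier S" "b = HR_class m n \<eta> a" by (rule HR_carrier_E)
  show "HR_class m n \<eta> (sm_par m n p) \<otimes>\<^bsub>H\<^esub> b = b \<otimes>\<^bsub>H\<^esub> HR_class m n \<eta> (sm_par m n p)"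
    using sm_par_central[OF a(1), of p] a(1) sm_par_closed[OF assms]
    by (simp add: a(2) flip: ring_hom_mult[OF HR_class_hom])
qed

lemma psi_one:
  assumes "a \<in> carrier S"
  shows "\<psi> \<one>\<^bsub>S\<^esub> * \<psi> a = \<psi> a"
  using psi_mult[OF S.one_closed assms] assms by simp

lemma psi_par_mult:
  assumes "p \<in> param_ring m" "q \<in> param_ring m"
  shows "\<psi> (sm_par m n (p * q)) = \<psi> (sm_par m n p) * \<psi> (sm_par m n q)"
  using assms by (simp add: sm_par_mult psi_mult sm_par_closed)

lemma psi_yx_diag:
  assumes "i \<in> {1..n}"
  shows "\<psi> (yx_diag m n \<eta> i) = \<psi> (sm_par m n (par_var Par_t)) - \<psi> (sm_par m n (par_var Par_kappa)) *
      (\<Sum>l\<in>{0..<m}. \<Sum>j\<in>{1..n} - {i}. \<psi> (sm_grp (sgg m n i j (int l))))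
    - (\<Sum>l\<in>{1..<m}. \<psi> (sm_par m n (par_var (Par_c l))) * \<psi> (sm_par m n (par_const (1 - \<eta> powi (- int l))))
        * \<psi> (sm_grp (g_pow m n i (int l))))"
  unfolding yx_diag_def Let_def
  using assms
  by (simp only: psi_minus psi_mult psi_finsum psi_par_mult sm_par_closed sm_grp_closed sgg_closed
      g_pow_closed par_closed param_ring_mult param_ring_const S.finsum_closed Pi_I S.m_closed
      S.minus_closed finite_atLeastLessThan finite_atLeastAtMost finite_Diff cong: sum.cong)

lemma psi_yx_offdiag:
  assumes "i \<in> {1..n}" "j \<in> {1..n} - {i}"
  shows "\<psi> (yx_offdiag m n \<eta> i j) = \<psi> (sm_par m n (par_var Par_kappa)) *
    (\<Sum>l\<in>{0..<m}. \<psi> (sm_par m n (par_const (\<eta> powi (- int l)))) * \<psi> (sm_grp (sgg m n i j (int l))))"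
  unfolding yx_offdiag_def Let_def
  using assms
  by (simp only: psi_mult psi_finsum sm_par_closed sm_grp_closed sgg_closed
      par_closed param_ring_const S.finsum_closed Pi_I S.m_closed finite_atLeastLessThan cong: sum.cong)

text \<open>The group and centrality laws hold already in the smash product; the commutation
  relations of the \<open>x\<close> and \<open>y\<close> hold because the generators of the ideal
  are mapped to zero.\<close>

lemma cherednik_relations_psi:
  "cherednik_relations m n \<eta> (\<psi> \<one>\<^bsub>S\<^esub>) (\<psi> (sm_par m n (par_var Par_t)))
    (\<psi> (sm_par m n (par_const (1/2) * par_var Par_t))) (\<psi> (sm_par m n (par_var Par_kappa)))
    (\<lambda>l. \<psi> (sm_par m n (par_var (Par_c l)))) (\<lambda>\<alpha>. \<psi> (sm_par m n (par_const \<alpha>)))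
    (\<lambda>w. \<psi> (sm_grp w)) (\<lambda>i. \<psi> (sm_x m n i)) (\<lambda>i. \<psi> (sm_y m n i))"
proof (rule cherednik_relations.intro[OF m eta])
  fix a
  show "\<psi> (sm_par m n (par_var Par_t)) * a = a * \<psi> (sm_par m n (par_var Par_t))"
    by (intro psi_par_central par_closed)
  show "\<psi> (sm_par m n (par_const (1/2) * par_var Par_t)) * a =
      a * \<psi> (sm_par m n (par_const (1/2) * par_var Par_t))"
    by (intro psi_par_central par_closed param_ring_mult param_ring_const)
  show "\<psi> (sm_par m n (par_var Par_kappa)) * a = a * \<psi> (sm_par m n (par_var Par_kappa))"
    by (intro psi_par_central par_closed)
  show "\<psi> (sm_par m n (par_var (Par_c l))) * a = a * \<psi> (sm_par m n (par_var (Par_c l)))"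
    if "l \<in> {1..<m}" for l
    using that by (intro psi_par_central par_closed)
  show "\<psi> (sm_par m n (par_const \<alpha>)) * a = a * \<psi> (sm_par m n (par_const \<alpha>))" for \<alpha>
    by (intro psi_par_central param_ring_const)
next
  fix \<alpha> \<beta>
  show "\<psi> (sm_par m n (par_const \<alpha>)) * \<psi> (sm_par m n (par_const \<beta>)) =
      \<psi> (sm_par m n (par_const (\<alpha> * \<beta>)))"
    by (simp add: param_ring_const flip: psi_par_mult par_const_mult)
  have "par_const \<alpha> = par_const (\<alpha> - \<beta>) + par_const \<beta>"
    by (simp add: par_const_diff)
  then have "\<psi> (sm_par m n (par_const \<alpha>)) =
      \<psi> (sm_par m n (par_const (\<alpha> - \<beta>))) + \<psi> (sm_par m n (par_const \<beta>))"
    by (metis sm_par_add psi_add sm_par_closed param_ring_const)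
  then show "\<psi> (sm_par m n (par_const (\<alpha> - \<beta>))) =
      \<psi> (sm_par m n (par_const \<alpha>)) - \<psi> (sm_par m n (par_const \<beta>))"
    by simp
next
  show "\<psi> (sm_par m n (par_const 1)) = \<psi> \<one>\<^bsub>S\<^esub>"
    by (simp add: par_const_1 sm_par_1)
  show "\<psi> \<one>\<^bsub>S\<^esub> * \<psi> (sm_grp w) = \<psi> (sm_grp w)" if "w \<in> carrier G" for w
    by (rule psi_one[OF sm_grp_closed[OF that]])
  show "\<psi> \<one>\<^bsub>S\<^esub> * \<psi> (sm_x m n i) = \<psi> (sm_x m n i)" if "i \<in> {1..n}" for i
    by (rule psi_one[OF sm_x_closed[OF that]])
  show "\<psi> \<one>\<^bsub>S\<^esub> * \<psi> (sm_y m n i) = \<psi> (sm_y m n i)" if "i \<in> {1..n}" for i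
    by (rule psi_one[OF sm_y_closed[OF that]])
  show "\<psi> \<one>\<^bsub>S\<^esub> * \<psi> (sm_par m n (par_const (1/2) * par_var Par_t)) =
      \<psi> (sm_par m n (par_const (1/2) * par_var Par_t))"
    by (intro psi_one sm_par_closed par_closed param_ring_mult param_ring_const)
next
  fix u w assume "u \<in> carrier G" "w \<in> carrier G"
  then show "\<psi> (sm_grp u) * \<psi> (sm_grp w) = \<psi> (sm_grp (u \<otimes>\<^bsub>G\<^esub> w))"
    by (simp add: sm_grp_closed flip: psi_mult sm_grp_mult)
next
  fix a \<sigma> i assume w: "(a, \<sigma>) \<in> carrier G" and i: "i \<in> {1..n}"
  have p: "\<sigma> permutes {1..n}" using w m by (simp add: carrier_Gm1n)
  have si: "\<sigma> i \<in> {1..n}" using i permutes_in_image[OF p] by blast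
  have "sm_grp (a, \<sigma>) \<otimes>\<^bsub>S\<^esub> sm_x m n i =
      sm_par m n (par_const (\<eta> powi (- a (\<sigma> i)))) \<otimes>\<^bsub>S\<^esub> sm_x m n (\<sigma> i) \<otimes>\<^bsub>S\<^esub> sm_grp (a, \<sigma>)"
    unfolding sm_x_def by (intro sm_grp_letter w letters_closed i si) simp
  then show "\<psi> (sm_grp (a, \<sigma>)) * \<psi> (sm_x m n i) =
      \<psi> (sm_par m n (par_const (\<eta> powi (- a (\<sigma> i))))) * \<psi> (sm_x m n (\<sigma> i)) * \<psi> (sm_grp (a, \<sigma>))"
    using w i si by (simp only: sm_grp_closed sm_x_closed sm_par_closed param_ring_const
        S.m_closed psi_mult[symmetric])
  have "sm_grp (a, \<sigma>) \<otimes>\<^bsub>S\<^esub> sm_y m n i =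
      sm_par m n (par_const (\<eta> powi (a (\<sigma> i)))) \<otimes>\<^bsub>S\<^esub> sm_y m n (\<sigma> i) \<otimes>\<^bsub>S\<^esub> sm_grp (a, \<sigma>)"
    unfolding sm_y_def by (intro sm_grp_letter w letters_closed i si) simp
  then show "\<psi> (sm_grp (a, \<sigma>)) * \<psi> (sm_y m n i) =
      \<psi> (sm_par m n (par_const (\<eta> powi (a (\<sigma> i))))) * \<psi> (sm_y m n (\<sigma> i)) * \<psi> (sm_grp (a, \<sigma>))"
    using w i si by (simp only: sm_grp_closed sm_y_closed sm_par_closed param_ring_const
        S.m_closed psi_mult[symmetric])
next
  fix i j assume ij: "i \<in> {1..n}" "j \<in> {1..n}"
  have "\<psi> (ring_commutator S (sm_x m n i) (sm_x m n j)) = 0"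
    by (rule psi_rel) (use ij in \<open>unfold cherednik_rels_def Let_def, blast\<close>)
  then show "\<psi> (sm_x m n i) * \<psi> (sm_x m n j) = \<psi> (sm_x m n j) * \<psi> (sm_x m n i)"
    using ij by (simp only: psi_commutator sm_x_closed right_minus_eq)
  have "\<psi> (ring_commutator S (sm_y m n i) (sm_y m n j)) = 0"
    by (rule psi_rel) (use ij in \<open>unfold cherednik_rels_def Let_def, blast\<close>)
  then show "\<psi> (sm_y m n i) * \<psi> (sm_y m n j) = \<psi> (sm_y m n j) * \<psi> (sm_y m n i)"
    using ij by (simp only: psi_commutator sm_y_closed right_minus_eq)
  have "\<psi> (ring_commutator S (sm_y m n i) (sm_x m n j) \<ominus>\<^bsub>S\<^esub> yx_offdiag m n \<eta> i j) = 0" if "i \<noteq> j"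
    by (rule psi_rel) (use ij that in \<open>unfold cherednik_rels_def Let_def, blast\<close>)
  moreover have "j \<in> {1..n} - {i}" if "i \<noteq> j" using ij that by blast
  ultimately show "\<psi> (sm_y m n i) * \<psi> (sm_x m n j) - \<psi> (sm_x m n j) * \<psi> (sm_y m n i) =
      \<psi> (sm_par m n (par_var Par_kappa)) *
      (\<Sum>l\<in>{0..<m}. \<psi> (sm_par m n (par_const (\<eta> powi (- int l)))) * \<psi> (sm_grp (sgg m n i j (int l))))"
    if "i \<noteq> j"
    using ij that psi_yx_offdiag[of i j]
    by (simp only: psi_minus psi_commutator commutator_closed sm_x_closed sm_y_closed
        yx_offdiag_closed right_minus_eq simp_thms)
next
  fix i assume i: "i \<in> {1..n}"
  have "\<psi> (ring_commutator S (sm_y m n i) (sm_x m n i) \<ominus>\<^bsub>S\<^esub> yx_diag m n \<eta> i) = 0"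
    by (rule psi_rel) (use i in \<open>unfold cherednik_rels_def Let_def, blast\<close>)
  then show "\<psi> (sm_y m n i) * \<psi> (sm_x m n i) - \<psi> (sm_x m n i) * \<psi> (sm_y m n i) =
      \<psi> (sm_par m n (par_var Par_t)) - \<psi> (sm_par m n (par_var Par_kappa)) *
      (\<Sum>l\<in>{0..<m}. \<Sum>j\<in>{1..n} - {i}. \<psi> (sm_grp (sgg m n i j (int l))))
    - (\<Sum>l\<in>{1..<m}. \<psi> (sm_par m n (par_var (Par_c l))) * \<psi> (sm_par m n (par_const (1 - \<eta> powi (- int l))))
        * \<psi> (sm_grp (g_pow m n i (int l))))"
    using i psi_yx_diag[OF i]
    by (simp only: psi_minus psi_commutator commutator_closed sm_x_closed sm_y_closed
        yx_diag_closed right_minus_eq)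
qed

sublocale rel: cherednik_relations m n \<eta> "\<psi> \<one>\<^bsub>S\<^esub>" "\<psi> (sm_par m n (par_var Par_t))"
  "\<psi> (sm_par m n (par_const (1/2) * par_var Par_t))" "\<psi> (sm_par m n (par_var Par_kappa))"
  "\<lambda>l. \<psi> (sm_par m n (par_var (Par_c l)))" "\<lambda>\<alpha>. \<psi> (sm_par m n (par_const \<alpha>))"
  "\<lambda>w. \<psi> (sm_grp w)" "\<lambda>i. \<psi> (sm_x m n i)" "\<lambda>i. \<psi> (sm_y m n i)"
  by (rule cherednik_relations_psi)

section \<open>Dunkl-Opdam elements of the generic algebra\<close>

lemmas HR_gen_defs = HR_x_def HR_y_def HR_grp_def HR_par_def

lemma HR_x_closed: "i \<in> {1..n} \<Longrightarrow> HR_x m n \<eta> i \<in> carrier H"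
  and HR_y_closed: "i \<in> {1..n} \<Longrightarrow> HR_y m n \<eta> i \<in> carrier H"
  and HR_grp_closed: "w \<in> carrier G \<Longrightarrow> HR_grp m n \<eta> w \<in> carrier H"
  and HR_par_closed: "p \<in> param_ring m \<Longrightarrow> HR_par m n \<eta> p \<in> carrier H"
  unfolding HR_gen_defs
  by (simp_all only: HR_class_closed sm_x_closed sm_y_closed sm_grp_closed sm_par_closed)

lemma embed_gens:
  "ring_embed H (HR_x m n \<eta> i) = \<psi> (sm_x m n i)"
  "ring_embed H (HR_y m n \<eta> i) = \<psi> (sm_y m n i)"
  "ring_embed H (HR_grp m n \<eta> w) = \<psi> (sm_grp w)"
  "ring_embed H (HR_par m n \<eta> p) = \<psi> (sm_par m n p)"
  by (simp_all only: HR_gen_defs \<psi>_def)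

lemmas embed_simps = ring_embed_add[OF H.ring_axioms] ring_embed_minus[OF H.ring_axioms]
  ring_embed_mult[OF H.ring_axioms] ring_embed_finsum[OF H.ring_axioms]

lemma embed_one: "ring_embed H \<one>\<^bsub>H\<^esub> = \<psi> \<one>\<^bsub>S\<^esub>"
  by (simp only: \<psi>_def ring_hom_one[OF HR_class_hom])

lemmas par_mult_const_closed = param_ring_mult[OF par_closed(3) param_ring_const]
  param_ring_mult[OF param_ring_const par_closed(1)]

lemma dunkl_opdam_closed_embed:
  assumes "i \<in> {1..n}"
  shows "dunkl_opdam m n \<eta> i \<in> carrier H"
    and "ring_embed H (dunkl_opdam m n \<eta> i) = rel.opdam {1..<i} i"
proof -
  have sgg: "sgg m n i j l \<in> carrier G" if "j \<in> {1..<i}" for j l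
    using that assms by (intro sgg_closed) auto
  show "dunkl_opdam m n \<eta> i \<in> carrier H"
    unfolding dunkl_opdam_def Let_def using assms
    by (intro H.a_closed H.minus_closed H.m_closed H.finsum_closed Pi_I HR_x_closed HR_y_closed
        HR_grp_closed HR_par_closed par_mult_const_closed par_closed sgg g_pow_closed)
  have "ring_embed H (dunkl_opdam m n \<eta> i) =
      \<psi> (sm_y m n i) * \<psi> (sm_x m n i) - \<psi> (sm_par m n (par_const (1/2) * par_var Par_t))
      + \<psi> (sm_par m n (par_var Par_kappa)) *
        (\<Sum>l\<in>{0..<m}. \<Sum>j\<in>{1..<i}. \<psi> (sm_grp (sgg m n i j (- int l))))
      - (\<Sum>l\<in>{1..<m}. \<psi> (sm_par m n (par_var (Par_c l) * par_const (\<eta> powi (- int l))))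
          * \<psi> (sm_grp (g_pow m n i (int l))))"
    unfolding dunkl_opdam_def Let_def using assms
    by (simp only: embed_simps embed_gens H.a_closed H.minus_closed H.m_closed H.finsum_closed Pi_I
        HR_x_closed HR_y_closed HR_grp_closed HR_par_closed par_mult_const_closed par_closed sgg
        g_pow_closed finite_atLeastLessThan cong: sum.cong)
  also have "(\<Sum>l\<in>{1..<m}. \<psi> (sm_par m n (par_var (Par_c l) * par_const (\<eta> powi (- int l))))
      * \<psi> (sm_grp (g_pow m n i (int l)))) = rel.cyc_sum i"
    unfolding rel.cyc_sum_def
    by (simp only: psi_par_mult par_closed param_ring_const cong: sum.cong)
  also have "(\<Sum>l\<in>{0..<m}. \<Sum>j\<in>{1..<i}. \<psi> (sm_grp (sgg m n i j (- int l)))) =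
      (\<Sum>j\<in>{1..<i}. \<Sum>l\<in>{0..<m}. \<psi> (sm_grp (sgg m n i j (- int l))))"
    by (rule sum.swap)
  \<comment> \<open>The definition of $z_i$ has the exponents of $g_i$ and $g_j$ with signs opposite
    to those in \<open>refl_sum\<close>; over all residues the two sums agree.\<close>
  also have "\<dots> = (\<Sum>j\<in>{1..<i}. rel.refl_sum i j)"
    using assms by (intro sum.cong refl rel.sum_sgg_uminus) auto
  finally show "ring_embed H (dunkl_opdam m n \<eta> i) = rel.opdam {1..<i} i"
    unfolding rel.opdam_def by (simp only: diff_conv_add_uminus add_ac)
qed

lemma dunkl_opdam_prod:
  assumes "set js \<subseteq> {1..n}"
  shows "foldr (\<lambda>j p. dunkl_opdam m n \<eta> j \<otimes>\<^bsub>H\<^esub> p) js \<one>\<^bsub>H\<^esub> \<in> carrier H"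
    and "ring_embed H (foldr (\<lambda>j p. dunkl_opdam m n \<eta> j \<otimes>\<^bsub>H\<^esub> p) js \<one>\<^bsub>H\<^esub>) =
      foldr (\<lambda>j p. rel.opdam {1..<j} j * p) js (\<psi> \<one>\<^bsub>S\<^esub>)"
proof -
  have "foldr (\<lambda>j p. dunkl_opdam m n \<eta> j \<otimes>\<^bsub>H\<^esub> p) js \<one>\<^bsub>H\<^esub> \<in> carrier H \<and>
    ring_embed H (foldr (\<lambda>j p. dunkl_opdam m n \<eta> j \<otimes>\<^bsub>H\<^esub> p) js \<one>\<^bsub>H\<^esub>) =
      foldr (\<lambda>j p. rel.opdam {1..<j} j * p) js (\<psi> \<one>\<^bsub>S\<^esub>)"
    using assms
  proof (induction js)
    case Nil
    then show ?case by (simp add: embed_one)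
  next
    case (Cons j js)
    then have "j \<in> {1..n}" by simp
    from dunkl_opdam_closed_embed[OF this] Cons show ?case by (simp add: embed_simps)
  qed
  then show "foldr (\<lambda>j p. dunkl_opdam m n \<eta> j \<otimes>\<^bsub>H\<^esub> p) js \<one>\<^bsub>H\<^esub> \<in> carrier H"
    and "ring_embed H (foldr (\<lambda>j p. dunkl_opdam m n \<eta> j \<otimes>\<^bsub>H\<^esub> p) js \<one>\<^bsub>H\<^esub>) =
      foldr (\<lambda>j p. rel.opdam {1..<j} j * p) js (\<psi> \<one>\<^bsub>S\<^esub>)"
    by blast+
qed

lemma dunkl_opdam_sym_closed_embed:
  shows "dunkl_opdam_sym m n \<eta> r \<in> carrier H"
    and "ring_embed H (dunkl_opdam_sym m n \<eta> r) = rel.opdam_esym r"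
proof -
  let ?J = "{J. J \<subseteq> {1..n} \<and> card J = r}"
  let ?p = "\<lambda>J. foldr (\<lambda>j p. dunkl_opdam m n \<eta> j \<otimes>\<^bsub>H\<^esub> p) (sorted_list_of_set J) \<one>\<^bsub>H\<^esub>"
  have fin: "finite ?J" by (rule finite_subset[of _ "Pow {1..n}"]) auto
  have J: "set (sorted_list_of_set J) \<subseteq> {1..n}" if "J \<in> ?J" for J
    using that finite_subset[of J "{1..n}"] by simp
  note prod = dunkl_opdam_prod[OF J]
  show "dunkl_opdam_sym m n \<eta> r \<in> carrier H"
    unfolding dunkl_opdam_sym_def Let_def using prod(1) by (intro H.finsum_closed Pi_I)
  have set: "set [1..<Suc n] = {1..n}"
    by (simp only: set_upt atLeastLessThanSuc_atLeastAtMost)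
  have "ring_embed H (dunkl_opdam_sym m n \<eta> r) = (\<Sum>J\<in>?J. ring_embed H (?p J))"
    unfolding dunkl_opdam_sym_def Let_def by (rule ring_embed_finsum[OF H.ring_axioms fin prod(1)])
  also have "\<dots> = (\<Sum>J\<in>?J. foldr (\<lambda>j p. rel.opdam {1..<j} j * p) (sorted_list_of_set J) (\<psi> \<one>\<^bsub>S\<^esub>))"
    by (rule sum.cong[OF refl prod(2)])
  also have "\<dots> = rel.opdam_esym r"
    unfolding rel.opdam_esym_def set[symmetric]
    by (rule sum_subsets_eq_esym) (rule sorted_wrt_upt)
  finally show "ring_embed H (dunkl_opdam_sym m n \<eta> r) = rel.opdam_esym r" .
qed

lemma component_psi: "a \<in> carrier S \<Longrightarrow> ring_component H (\<psi> a) = HR_class m n \<eta> a"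
  unfolding \<psi>_def by (rule ring_component_embed[OF H.ring_axioms HR_class_closed])

lemma commutator_in_t_ideal:
  assumes "a \<in> carrier H" "ring_embed H a * rel.opdam_esym r - rel.opdam_esym r * ring_embed H a =
    \<psi> (sm_par m n (par_var Par_t)) * f"
  shows "\<exists>h\<in>carrier H. ring_commutator H a (dunkl_opdam_sym m n \<eta> r) =
    HR_par m n \<eta> (par_var Par_t) \<otimes>\<^bsub>H\<^esub> h"
proof
  \<comment> \<open>The factor \<open>f\<close> may lie outside the image of the embedding.
    Projection to the component at \<open>H\<close> is multiplicative, so its component there serves
    as witness.\<close>
  show "ring_component H f \<in> carrier H" by (rule ring_component_closed[OF H.ring_axioms])
  note E = dunkl_opdam_sym_closed_embed[of r]
  have "ring_embed H (ring_commutator H a (dunkl_opdam_sym m n \<eta> r)) =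
      \<psi> (sm_par m n (par_var Par_t)) * f"
    unfolding ring_commutator_def assms(2)[symmetric] E(2)[symmetric]
    by (simp only: embed_simps H.m_closed assms(1) E(1))
  then have "ring_component H (ring_embed H (ring_commutator H a (dunkl_opdam_sym m n \<eta> r))) =
      ring_component H (\<psi> (sm_par m n (par_var Par_t)) * f)" by (simp only:)
  then show "ring_commutator H a (dunkl_opdam_sym m n \<eta> r) =
      HR_par m n \<eta> (par_var Par_t) \<otimes>\<^bsub>H\<^esub> ring_component H f"
    unfolding ring_component_mult[OF H.ring_axioms] component_psi[OF sm_par_closed[OF par_closed(1)]]
      HR_par_def ring_commutator_def
    by (simp only: ring_component_embed[OF H.ring_axioms] H.m_closed H.minus_closed assms(1) E(1))
qed

lemma x_dunkl_opdam_sym: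
  assumes "j \<in> {1..n}" "1 \<le> r"
  shows "\<exists>h\<in>carrier H. ring_commutator H (HR_x m n \<eta> j) (dunkl_opdam_sym m n \<eta> r) =
    HR_par m n \<eta> (par_var Par_t) \<otimes>\<^bsub>H\<^esub> h"
proof -
  obtain s where "r = Suc s" using assms(2) by (cases r) auto
  then show ?thesis
    using rel.x_opdam_esym[OF assms(1), of s] commutator_in_t_ideal[OF HR_x_closed[OF assms(1)]]
    unfolding embed_gens by blast
qed

lemma y_dunkl_opdam_sym:
  assumes "j \<in> {1..n}" "1 \<le> r"
  shows "\<exists>h\<in>carrier H. ring_commutator H (HR_y m n \<eta> j) (dunkl_opdam_sym m n \<eta> r) =
    HR_par m n \<eta> (par_var Par_t) \<otimes>\<^bsub>H\<^esub> h"
proof -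
  obtain s where "r = Suc s" using assms(2) by (cases r) auto
  then show ?thesis
    using rel.y_opdam_esym[OF assms(1), of s] commutator_in_t_ideal[OF HR_y_closed[OF assms(1)]]
    unfolding embed_gens by blast
qed

lemma grp_dunkl_opdam_sym:
  assumes "w \<in> carrier G"
  shows "HR_grp m n \<eta> w \<otimes>\<^bsub>H\<^esub> dunkl_opdam_sym m n \<eta> r =
    dunkl_opdam_sym m n \<eta> r \<otimes>\<^bsub>H\<^esub> HR_grp m n \<eta> w"
proof -
  obtain a \<sigma> where w: "w = (a, \<sigma>)" by (cases w)
  have "\<psi> (sm_grp w) * rel.opdam_esym r = rel.opdam_esym r * \<psi> (sm_grp w)"
    using rel.gamma_opdam_esym[of a \<sigma> r] assms unfolding w by blast
  note comm = this and closed = HR_grp_closed[OF assms] and E = dunkl_opdam_sym_closed_embed[of r]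
  have "ring_embed H (HR_grp m n \<eta> w \<otimes>\<^bsub>H\<^esub> dunkl_opdam_sym m n \<eta> r) =
    ring_embed H (dunkl_opdam_sym m n \<eta> r \<otimes>\<^bsub>H\<^esub> HR_grp m n \<eta> w)"
    by (simp only: embed_simps embed_gens E closed comm)
  then show ?thesis
    using ring_embed_eq_iff[OF H.ring_axioms H.m_closed[OF closed E(1)] H.m_closed[OF E(1) closed]]
    by (simp only:)
qed

text \<open>An element is the sum of its monomials \<open>smash_monom (f w) w\<close>; each is a
  tensor times a group element, and tensors are generated by scalars and letters. Commutation with a
  fixed element can thus be checked on generators.\<close>

lemma S_induct [consumes 1, case_names par x y grp add mult]:
  assumes "f \<in> carrier S"
    and "\<And>p. p \<in> param_ring m \<Longrightarrow> P (sm_par m n p)"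
    and "\<And>i. i \<in> {1..n} \<Longrightarrow> P (sm_x m n i)" "\<And>i. i \<in> {1..n} \<Longrightarrow> P (sm_y m n i)"
    and "\<And>w. w \<in> carrier G \<Longrightarrow> P (sm_grp w)"
    and "\<And>f g. f \<in> carrier S \<Longrightarrow> g \<in> carrier S \<Longrightarrow> P f \<Longrightarrow> P g \<Longrightarrow> P (f \<oplus>\<^bsub>S\<^esub> g)"
    and "\<And>f g. f \<in> carrier S \<Longrightarrow> g \<in> carrier S \<Longrightarrow> P f \<Longrightarrow> P g \<Longrightarrow> P (f \<otimes>\<^bsub>S\<^esub> g)"
  shows "P f"
proof -
  have tensor: "P (smash_monom a \<one>\<^bsub>G\<^esub>)" if "a \<in> A" for a
    using that
  proof (induction rule: tensor_algebra_induct)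
    case (scalar p)
    then show ?case using assms(2) by (simp add: sm_par_def)
  next
    case (letter v)
    then obtain i where "i \<in> {1..n}" "v = Let_x i \<or> v = Let_y i"
      by (auto simp only: algebra_letters_def)
    then show ?case using assms(3,4)[of i] by (auto simp only: sm_x_def sm_y_def)
  next
    case (add a b)
    have "smash_monom (a + b) \<one>\<^bsub>G\<^esub> = smash_monom a \<one>\<^bsub>G\<^esub> \<oplus>\<^bsub>S\<^esub> smash_monom b \<one>\<^bsub>G\<^esub>"
      by (auto simp add: action.smash_add[unfolded S_eq] smash_monom_def)
    then show ?case using add by (simp add: assms(6) smash_monom_closed)
  next
    case (mult a b)
    have "smash_monom (a * b) \<one>\<^bsub>G\<^esub> = smash_monom a \<one>\<^bsub>G\<^esub> \<otimes>\<^bsub>S\<^esub> smash_monom b \<one>\<^bsub>G\<^esub>"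
      using mult by (simp add: smash_monom_mult action.act_id)
    then show ?case using mult by (simp add: assms(7) smash_monom_closed)
  qed
  have monom: "P (smash_monom a w)" "smash_monom a w \<in> carrier S" if "a \<in> A" "w \<in> carrier G" for a w
  proof -
    have "smash_monom a w = smash_monom a \<one>\<^bsub>G\<^esub> \<otimes>\<^bsub>S\<^esub> sm_grp w"
      using that by (simp add: sm_grp_def smash_monom_mult action.act_1)
    then show "P (smash_monom a w)"
      using that by (simp only: assms(5,7) tensor smash_monom_closed G.one_closed sm_grp_closed)
    show "smash_monom a w \<in> carrier S" using that by (rule smash_monom_closed)
  qed
  have fA: "f w \<in> A" if "w \<in> carrier G" for w
    using assms(1) that action.smash_carrier[unfolded S_eq] by blast
  have "P (\<Oplus>\<^bsub>S\<^esub>w\<in>W. smash_monom (f w) w)" if "finite W" "W \<subseteq> carrier G" for W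
    using that
  proof (induction W rule: finite_induct)
    case empty
    then show ?case using assms(2)[OF param_ring_0] by (simp add: sm_par_0)
  next
    case (insert w W)
    then have W: "\<And>v. v \<in> W \<Longrightarrow> smash_monom (f v) v \<in> carrier S" "w \<in> carrier G"
      using monom(2)[OF fA] by auto
    have "(\<Oplus>\<^bsub>S\<^esub>w\<in>insert w W. smash_monom (f w) w) =
        smash_monom (f w) w \<oplus>\<^bsub>S\<^esub> (\<Oplus>\<^bsub>S\<^esub>w\<in>W. smash_monom (f w) w)"
      using insert.hyps W monom(2)[OF fA[OF W(2)] W(2)] by (intro S.finsum_insert) auto
    then show ?case
      using insert monom[OF fA[OF W(2)] W(2)] W(1)
      by (auto intro!: assms(6) S.finsum_closed)
  qed
  from this[OF action.finite order_refl] show ?thesis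
    using action.smash_expand[unfolded S_eq, OF assms(1)] by simp
qed

section \<open>Centrality after specialisation\<close>

lemma specialisation_ideal_gens_closed:
  "{HR_par m n \<eta> (par_var Par_t), HR_par m n \<eta> (par_var Par_kappa - par_const \<kappa>)}
    \<union> {HR_par m n \<eta> (par_var (Par_c l) - par_const (c l)) | l. l \<in> {1..<m}} \<subseteq> carrier H"
  using HR_par_closed[OF par_closed(1)] HR_par_closed[OF param_ring_diff[OF par_closed(2) param_ring_const]]
    HR_par_closed[OF param_ring_diff[OF par_closed(3) param_ring_const]]
  by blast

text \<open>Parameters and group elements commute with the symmetric function before specialisation.
  For the \<open>x\<close> and \<open>y\<close> the commutator is a multiple of $t$, which lies in
  the specialisation ideal. The elements commuting with a given one are closed under sums and
  products, so the generators suffice.\<close>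

lemma Hc_image_central:
  assumes "1 \<le> r"
  shows "Hc_image m n \<eta> \<kappa> c (dunkl_opdam_sym m n \<eta> r) \<in> ring_center (Hc m n \<eta> \<kappa> c)"
proof -
  let ?E = "dunkl_opdam_sym m n \<eta> r" and ?\<pi> = "Hc_image m n \<eta> \<kappa> c" and ?K = "Hc m n \<eta> \<kappa> c"
  let ?T = "HR_par m n \<eta> (par_var Par_t)"
  interpret J: ideal "specialisation_ideal m n \<eta> \<kappa> c" H
    unfolding specialisation_ideal_def
    by (rule H.genideal_ideal[OF specialisation_ideal_gens_closed])
  interpret K: Ring.ring ?K
    unfolding Hc_def by (rule J.quotient_is_ring)
  have hom: "?\<pi> \<in> ring_hom H ?K"
    unfolding Hc_def using J.rcos_ring_hom by (simp add: Hc_image_def[abs_def])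
  note pi_simps = ring_hom_add[OF hom] ring_hom_mult[OF hom]
  have pi_closed: "?\<pi> a \<in> carrier ?K" if "a \<in> carrier H" for a
    using that by (rule ring_hom_closed[OF hom])
  have E: "?E \<in> carrier H" by (rule dunkl_opdam_sym_closed_embed(1))
  have "?T \<in> specialisation_ideal m n \<eta> \<kappa> c"
    unfolding specialisation_ideal_def
    using H.genideal_self[OF specialisation_ideal_gens_closed[of \<kappa> c]] by blast
  then have T0: "?\<pi> ?T = \<zero>\<^bsub>?K\<^esub>"
    unfolding Hc_image_def Hc_def by (simp add: FactRing_def J.a_rcos_const)
  have T: "?T \<in> carrier H" by (rule HR_par_closed[OF par_closed(1)])
  have commute: "?\<pi> a \<otimes>\<^bsub>?K\<^esub> ?\<pi> ?E = ?\<pi> ?E \<otimes>\<^bsub>?K\<^esub> ?\<pi> a"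
    if a: "a \<in> carrier H" and ex: "\<exists>h\<in>carrier H. ring_commutator H a ?E = ?T \<otimes>\<^bsub>H\<^esub> h" for a
  proof -
    obtain h where h: "h \<in> carrier H" "ring_commutator H a ?E = ?T \<otimes>\<^bsub>H\<^esub> h"
      using ex by (rule bexE)
    have "a \<otimes>\<^bsub>H\<^esub> ?E = ring_commutator H a ?E \<oplus>\<^bsub>H\<^esub> ?E \<otimes>\<^bsub>H\<^esub> a"
      using a E by (simp add: ring_commutator_def a_minus_def H.a_assoc H.l_neg)
    also note h(2)
    finally have "?\<pi> (a \<otimes>\<^bsub>H\<^esub> ?E) = ?\<pi> (?T \<otimes>\<^bsub>H\<^esub> h \<oplus>\<^bsub>H\<^esub> ?E \<otimes>\<^bsub>H\<^esub> a)" by simp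
    then show ?thesis
      using a E h(1) T by (simp add: pi_simps T0 pi_closed)
  qed
  have commute_all: "?\<pi> (HR_class m n \<eta> f) \<otimes>\<^bsub>?K\<^esub> ?\<pi> ?E = ?\<pi> ?E \<otimes>\<^bsub>?K\<^esub> ?\<pi> (HR_class m n \<eta> f)"
    if "f \<in> carrier S" for f
    using that
  proof (induction rule: S_induct)
    case (par p)
    obtain b where b: "b \<in> carrier S" "?E = HR_class m n \<eta> b" by (rule HR_carrier_E[OF E])
    have "HR_class m n \<eta> (sm_par m n p) \<otimes>\<^bsub>H\<^esub> ?E = ?E \<otimes>\<^bsub>H\<^esub> HR_class m n \<eta> (sm_par m n p)"
      using sm_par_central[OF b(1), of p] b(1) sm_par_closed[OF par]
      by (simp add: b(2) flip: ring_hom_mult[OF HR_class_hom])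
    then show ?case
      using E HR_class_closed[OF sm_par_closed[OF par]] by (simp flip: ring_hom_mult[OF hom])
  next
    case (x i)
    from commute[OF HR_x_closed[OF this] x_dunkl_opdam_sym[OF this assms]]
    show ?case by (simp only: HR_x_def)
  next
    case (y i)
    from commute[OF HR_y_closed[OF this] y_dunkl_opdam_sym[OF this assms]]
    show ?case by (simp only: HR_y_def)
  next
    case (grp w)
    from grp_dunkl_opdam_sym[OF this, of r]
    show ?case
      using E HR_grp_closed[OF grp] unfolding HR_grp_def by (simp flip: ring_hom_mult[OF hom])
  next
    case (add f g)
    then show ?case
      using E by (simp add: ring_hom_add[OF HR_class_hom] ring_hom_add[OF hom] HR_class_closed
          pi_closed K.l_distr K.r_distr)
  next
    case (mult f g)
    let ?f = "?\<pi> (HR_class m n \<eta> f)" and ?g = "?\<pi> (HR_class m n \<eta> g)"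
    have c: "?f \<in> carrier ?K" "?g \<in> carrier ?K" "?\<pi> ?E \<in> carrier ?K"
      using mult.hyps E by (simp_all add: HR_class_closed pi_closed)
    have "?f \<otimes>\<^bsub>?K\<^esub> ?g \<otimes>\<^bsub>?K\<^esub> ?\<pi> ?E = ?f \<otimes>\<^bsub>?K\<^esub> (?\<pi> ?E \<otimes>\<^bsub>?K\<^esub> ?g)"
      using c mult.IH(2) by (simp add: K.m_assoc)
    also have "\<dots> = ?\<pi> ?E \<otimes>\<^bsub>?K\<^esub> (?f \<otimes>\<^bsub>?K\<^esub> ?g)"
      using c mult.IH(1) by (simp flip: K.m_assoc)
    finally show ?case
      using mult.hyps
      by (simp add: ring_hom_mult[OF HR_class_hom] ring_hom_mult[OF hom] HR_class_closed)
  qed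
  show ?thesis
    unfolding ring_center_def
  proof (intro CollectI conjI ballI pi_closed E)
    fix b assume "b \<in> carrier ?K"
    then obtain a where a: "a \<in> carrier H" "b = ?\<pi> a"
      unfolding Hc_def FactRing_def A_RCOSETS_def' Hc_image_def by auto
    from a(1) obtain f where "f \<in> carrier S" "a = HR_class m n \<eta> f" by (rule HR_carrier_E)
    with commute_all[of f] a(2) show "?\<pi> ?E \<otimes>\<^bsub>?K\<^esub> b = b \<otimes>\<^bsub>?K\<^esub> ?\<pi> ?E"
      by simp
  qed
qed

end

theorem theorem3p4:
  fixes m n r :: nat and \<eta> :: complex
  assumes "m \<ge> 1" and "n \<ge> 1"
    and "primitive_root_of_unity m \<eta>"
    and "1 \<le> r" and "r \<le> n"
  shows "(\<exists>h \<in> carrier (HR m n \<eta>).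
            ring_commutator (HR m n \<eta>) (HR_x m n \<eta> 1) (dunkl_opdam_sym m n \<eta> r)
              = HR_par m n \<eta> (par_var Par_t) \<otimes>\<^bsub>HR m n \<eta>\<^esub> h)
       \<and> (\<forall>(\<kappa> :: complex) (c :: nat \<Rightarrow> complex).
            Hc_image m n \<eta> \<kappa> c (dunkl_opdam_sym m n \<eta> r) \<in> ring_center (Hc m n \<eta> \<kappa> c))"
proof -
  interpret cherednik m n \<eta>
    using assms(1,3) by unfold_locales (simp_all add: primitive_root_of_unity_def)
  have "1 \<in> {1..n}" using assms(2) by simp
  then show ?thesis using x_dunkl_opdam_sym Hc_image_central assms(4) by blast
qed

end
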